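(* Let $K$ be a separably closed field of characteristic three, $X=\mathbb{P}^2_K$, $Y=\mathbb{P}^2_{K^{1/3}}$. If $P$ is a point of $X$ whose residue field $\mathbf{k}(X,P)$ is a degree three extension of $K$, and $P^1$ is the point of $Y$ lying over $P$, then $P^1$ is of $1$-type $1$ or of $1$-type $2$.
   Context: The base change morphism $\pi\colon Y\to X$ is a homeomorphism, and $P^1$ is the unique point of $Y$ over $P$. A closed subscheme of $Y$ is $X$-invariant if its ideal sheaf $\mathcal{I}$ is $X$-invariant, i.e. stable under all local $\mathcal{O}_X$-derivations of $\mathcal{O}_Y$; equivalently, it is the base change of a closed subscheme of $X$ (it can be defined by homogeneous polynomials with coefficients in $K$). A closed subscheme $Z$ of $Y$ is of $m$-type $k$ when $k$ is the smallest degree of an $X$-invariant $m$-dimensional subvariety of $Y$ whose ideal sheaf is contained in the ideal sheaf of $Z$. Thus the $1$-type of a point is the smallest degree of an $X$-invariant curve through it. *)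

theory Defs
  imports
    "HOL-Library.Poly_Mapping"
    "HOL-Library.Numeral_Type"
    "HOL-Computational_Algebra.Computational_Algebra"
begin

text \<open>Every irreducible separable polynomial is linear; an irreducible polynomial is separable
  when it is coprime to its derivative.\<close>

definition separably_closed :: "'k::field itself \<Rightarrow> bool" where
  "separably_closed _ \<longleftrightarrow>
     (\<forall>p::'k poly. irreducible p \<and> coprime p (pderiv p) \<longrightarrow> degree p = 1)"

definition field_embedding :: "('k::field \<Rightarrow> 'l::field) \<Rightarrow> bool" where
  "field_embedding \<iota> \<longleftrightarrow> \<iota> 1 = 1 \<and> (\<forall>a b. \<iota> (a + b) = \<iota> a + \<iota> b) \<and> (\<forall>a b. \<iota> (a * b) = \<iota> a * \<iota> b)"

text \<open>For \<open>K\<close> of characteristic \<open>p\<close>, the extension \<open>L = K\<^bsup>1/p\<^esup>\<close> of \<open>K\<close> is determined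
  up to unique isomorphism by the condition that the \<open>p\<close>-th powers of elements of \<open>L\<close> are
  exactly the elements of \<open>K\<close>.\<close>

definition frobenius_root_field :: "('k::field \<Rightarrow> 'l::field) \<Rightarrow> bool" where
  "frobenius_root_field \<iota> \<longleftrightarrow> field_embedding \<iota> \<and> range (\<lambda>x. x ^ CHAR('k)) = range \<iota>"

text \<open>\<open>quotient_dim s V W d\<close>: the vector space \<open>V / W\<close> has dimension \<open>d\<close>, where \<open>W \<subseteq> V\<close> are
  subspaces for the scalar multiplication \<open>s\<close>. The elements of \<open>B\<close> represent a basis.\<close>

definition quotient_dim ::
    "('k::field \<Rightarrow> 'v::ab_group_add \<Rightarrow> 'v) \<Rightarrow> 'v set \<Rightarrow> 'v set \<Rightarrow> nat \<Rightarrow> bool" where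
  "quotient_dim s V W d \<longleftrightarrow>
     (\<exists>B\<subseteq>V. finite B \<and> card B = d \<and>
        (\<forall>v\<in>V. \<exists>!c. c \<in> (B \<rightarrow>\<^sub>E UNIV) \<and> v - (\<Sum>b\<in>B. s (c b) b) \<in> W))"

text \<open>\<open>('v, 'k) mpoly\<close> is the polynomial ring over \<open>'k\<close> with variables indexed by \<open>'v\<close>. Its
  \<open>Proj\<close> is the projective space of dimension \<open>CARD('v) - 1\<close>. The linear order on \<open>'v\<close> only serves
  to obtain the integral domain instance.\<close>

type_synonym ('v, 'k) mpoly = "('v \<Rightarrow>\<^sub>0 nat) \<Rightarrow>\<^sub>0 'k"

definition scalar :: "'k \<Rightarrow> ('v, 'k::field) mpoly" where
  "scalar c = Poly_Mapping.single 0 c"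

definition homogeneous :: "nat \<Rightarrow> ('v::finite, 'k::field) mpoly \<Rightarrow> bool" where
  "homogeneous n f \<longleftrightarrow> (\<forall>m\<in>Poly_Mapping.keys f. (\<Sum>i\<in>UNIV. Poly_Mapping.lookup m i) = n)"

definition hom_component :: "nat \<Rightarrow> ('v::finite, 'k::field) mpoly \<Rightarrow> ('v, 'k) mpoly" where
  "hom_component n f =
     (\<Sum>m | m \<in> Poly_Mapping.keys f \<and> (\<Sum>i\<in>UNIV. Poly_Mapping.lookup m i) = n. Poly_Mapping.single m (Poly_Mapping.lookup f m))"

definition homogeneous_ideal :: "('v::finite, 'k::field) mpoly set \<Rightarrow> bool" where
  "homogeneous_ideal I \<longleftrightarrow>
     0 \<in> I \<and> (\<forall>f\<in>I. \<forall>g\<in>I. f + g \<in> I) \<and> (\<forall>f\<in>I. \<forall>h. h * f \<in> I) \<and>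
     (\<forall>f\<in>I. \<forall>n. hom_component n f \<in> I)"

definition irrelevant_ideal :: "('v, 'k::field) mpoly set" where
  "irrelevant_ideal = {f. Poly_Mapping.lookup f 0 = 0}"

text \<open>The points of \<open>Proj\<close>: homogeneous primes not containing the irrelevant ideal. By passing to
  generic points, they also stand for the integral closed subschemes (the subvarieties).\<close>

definition proj_points :: "('v::finite, 'k::field) mpoly set set" where
  "proj_points = {p. homogeneous_ideal p \<and> 1 \<notin> p \<and> (\<forall>f g. f * g \<in> p \<longrightarrow> f \<in> p \<or> g \<in> p) \<and>
     \<not> irrelevant_ideal \<subseteq> p}"

definition zariski_open :: "('v::finite, 'k::field) mpoly set set \<Rightarrow> bool" where
  "zariski_open U \<longleftrightarrow> (\<exists>I. homogeneous_ideal I \<and> U = {p \<in> proj_points. \<not> I \<subseteq> p})"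

text \<open>As projective space is integral, its local rings, and its rings of sections over nonempty
  open sets, are taken inside the function field, which consists of the homogeneous elements of
  degree zero of the fraction field of the polynomial ring; restriction maps are inclusions.
  \<open>stalk I p\<close> is the degree zero part of the homogeneous localization of the homogeneous
  ideal \<open>I\<close> at \<open>p\<close>.\<close>

definition stalk ::
    "('v::{finite,linorder}, 'k::field) mpoly set \<Rightarrow> ('v, 'k) mpoly set \<Rightarrow> ('v, 'k) mpoly fract set" where
  "stalk I p = {Fract f g | f g n. homogeneous n f \<and> homogeneous n g \<and> f \<in> I \<and> g \<notin> p}"

abbreviation local_ring ::
    "('v::{finite,linorder}, 'k::field) mpoly set \<Rightarrow> ('v, 'k) mpoly fract set" where
  "local_ring p \<equiv> stalk UNIV p"

abbreviation max_ideal ::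
    "('v::{finite,linorder}, 'k::field) mpoly set \<Rightarrow> ('v, 'k) mpoly fract set" where
  "max_ideal p \<equiv> stalk p p"

definition residue_degree :: "('v::{finite,linorder}, 'k::field) mpoly set \<Rightarrow> nat \<Rightarrow> bool" where
  "residue_degree p d \<longleftrightarrow>
     quotient_dim (\<lambda>c \<phi>. Fract (scalar c) 1 * \<phi>) (local_ring p) (max_ideal p) d"

text \<open>Sections over a nonempty open set \<open>U\<close> of the ideal sheaf of the closed subscheme defined by
  the homogeneous ideal \<open>I\<close>; the unit ideal gives the structure sheaf. The empty open set is
  excluded wherever these are used.\<close>

definition ideal_sheaf ::
    "('v::{finite,linorder}, 'k::field) mpoly set \<Rightarrow> ('v, 'k) mpoly set set \<Rightarrow> ('v, 'k) mpoly fract set" where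
  "ideal_sheaf I U = {\<phi>. \<forall>p\<in>U. \<phi> \<in> stalk I p}"

abbreviation structure_sheaf ::
    "('v::{finite,linorder}, 'k::field) mpoly set set \<Rightarrow> ('v, 'k) mpoly fract set" where
  "structure_sheaf U \<equiv> ideal_sheaf UNIV U"

text \<open>Krull dimension. Irreducible closed subsets of the subvariety with generic point \<open>q\<close>
  correspond to points \<open>p \<supseteq> q\<close>, and a chain of length \<open>m\<close> has \<open>m + 1\<close> members.\<close>

definition specialization_chain ::
    "('v::finite, 'k::field) mpoly set \<Rightarrow> ('v, 'k) mpoly set list \<Rightarrow> bool" where
  "specialization_chain q ps \<longleftrightarrow> set ps \<subseteq> {p \<in> proj_points. q \<subseteq> p} \<and> sorted_wrt (\<subset>) ps"

definition subvariety_dim :: "('v::finite, 'k::field) mpoly set \<Rightarrow> nat \<Rightarrow> bool" where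
  "subvariety_dim q m \<longleftrightarrow>
     (\<exists>ps. specialization_chain q ps \<and> length ps = m + 1) \<and>
     (\<forall>ps. specialization_chain q ps \<longrightarrow> length ps \<le> m + 1)"

definition hilbert_polynomial :: "('v::finite, 'k::field) mpoly set \<Rightarrow> rat poly \<Rightarrow> bool" where
  "hilbert_polynomial q h \<longleftrightarrow>
     (\<forall>\<^sub>F n in sequentially. \<exists>d.
        quotient_dim (\<lambda>c f. scalar c * f) {f. homogeneous n f} {f \<in> q. homogeneous n f} d \<and>
        poly h (of_nat n) = of_nat d)"

text \<open>The degree of a subvariety of dimension \<open>r\<close> is \<open>r!\<close> times the leading coefficient of its
  Hilbert polynomial, which has degree \<open>r\<close>.\<close>

definition subvariety_degree :: "('v::finite, 'k::field) mpoly set \<Rightarrow> nat \<Rightarrow> bool" where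
  "subvariety_degree q d \<longleftrightarrow>
     (\<exists>h. hilbert_polynomial q h \<and> of_nat d = fact (degree h) * lead_coeff h)"

text \<open>Below, \<open>\<iota>\<close> is the embedding of \<open>K\<close> into \<open>L\<close>, \<open>X\<close> and \<open>Y\<close> are the projective spaces
  over \<open>K\<close> and \<open>L\<close>, and \<open>\<pi> = base_change \<iota>\<close> is the base change morphism from \<open>Y\<close> to \<open>X\<close> on points.\<close>

definition base_change :: "('k::field \<Rightarrow> 'l::field) \<Rightarrow> ('v, 'l) mpoly set \<Rightarrow> ('v, 'k) mpoly set" where
  "base_change \<iota> p = {f. Poly_Mapping.map \<iota> f \<in> p}"

definition pullback_sections ::
    "('k::field \<Rightarrow> 'l::field) \<Rightarrow> ('v::{finite,linorder}, 'k) mpoly set set \<Rightarrow> ('v, 'l) mpoly fract set" where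
  "pullback_sections \<iota> W =
     {Fract (Poly_Mapping.map \<iota> f) (Poly_Mapping.map \<iota> g) | f g. g \<noteq> 0 \<and> Fract f g \<in> structure_sheaf W}"

text \<open>\<open>D\<close> is an \<open>\<O>\<^sub>X\<close>-derivation of the restriction of \<open>\<O>\<^sub>Y\<close> to \<open>U\<close>: a family of
  derivations \<open>D V\<close> of the rings of sections over the nonempty open \<open>V \<subseteq> U\<close>, compatible with
  restriction, that vanish on the sections pulled back from \<open>X\<close>, that is, on those over some
  open \<open>W\<close> with \<open>V \<subseteq> \<pi>\<^bsup>-1\<^esup>(W)\<close>. Linearity over \<open>\<O>\<^sub>X\<close> follows.\<close>

definition local_derivation ::
    "('k::field \<Rightarrow> 'l::field) \<Rightarrow> ('v::{finite,linorder}, 'l) mpoly set set \<Rightarrow>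
     (('v, 'l) mpoly set set \<Rightarrow> ('v, 'l) mpoly fract \<Rightarrow> ('v, 'l) mpoly fract) \<Rightarrow> bool" where
  "local_derivation \<iota> U D \<longleftrightarrow>
     (\<forall>V. zariski_open V \<and> V \<noteq> {} \<and> V \<subseteq> U \<longrightarrow>
        (\<forall>\<phi>\<in>structure_sheaf V. D V \<phi> \<in> structure_sheaf V) \<and>
        (\<forall>\<phi>\<in>structure_sheaf V. \<forall>\<psi>\<in>structure_sheaf V.
           D V (\<phi> + \<psi>) = D V \<phi> + D V \<psi> \<and> D V (\<phi> * \<psi>) = \<phi> * D V \<psi> + \<psi> * D V \<phi>) \<and>
        (\<forall>W. zariski_open W \<and> base_change \<iota> ` V \<subseteq> W \<longrightarrow>
           (\<forall>\<phi>\<in>pullback_sections \<iota> W. D V \<phi> = 0)) \<and>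
        (\<forall>V'. zariski_open V' \<and> V' \<noteq> {} \<and> V' \<subseteq> V \<longrightarrow>
           (\<forall>\<phi>\<in>structure_sheaf V. D V' \<phi> = D V \<phi>)))"

definition X_invariant ::
    "('k::field \<Rightarrow> 'l::field) \<Rightarrow> ('v::{finite,linorder}, 'l) mpoly set \<Rightarrow> bool" where
  "X_invariant \<iota> I \<longleftrightarrow>
     (\<forall>U D. zariski_open U \<and> U \<noteq> {} \<and> local_derivation \<iota> U D \<longrightarrow>
        (\<forall>V. zariski_open V \<and> V \<noteq> {} \<and> V \<subseteq> U \<longrightarrow>
           (\<forall>\<phi>\<in>ideal_sheaf I V. D V \<phi> \<in> ideal_sheaf I V)))"

definition invariant_degree ::
    "('k::field \<Rightarrow> 'l::field) \<Rightarrow> nat \<Rightarrow> ('v::{finite,linorder}, 'l) mpoly set \<Rightarrow> nat \<Rightarrow> bool" where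
  "invariant_degree \<iota> m J d \<longleftrightarrow>
     (\<exists>q\<in>proj_points. X_invariant \<iota> q \<and> subvariety_dim q m \<and> subvariety_degree q d \<and>
        (\<forall>U. zariski_open U \<and> U \<noteq> {} \<longrightarrow> ideal_sheaf q U \<subseteq> ideal_sheaf J U))"

text \<open>The closed subscheme of \<open>Y\<close> defined by the homogeneous ideal \<open>J\<close> is of \<open>m\<close>-type \<open>k\<close>.\<close>

definition of_type ::
    "('k::field \<Rightarrow> 'l::field) \<Rightarrow> nat \<Rightarrow> ('v::{finite,linorder}, 'l) mpoly set \<Rightarrow> nat \<Rightarrow> bool" where
  "of_type \<iota> m J k \<longleftrightarrow> invariant_degree \<iota> m J k \<and> (\<forall>d. invariant_degree \<iota> m J d \<longrightarrow> k \<le> d)"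

end

theory Submission
  imports Defs
begin

text \<open>The homogeneous coordinates \<open>x\<close>, \<open>y\<close>, \<open>z\<close> of \<open>P\<close>, divided by a nonzero one \<open>x\<close>, generate a residue
  field of dimension three over \<open>K\<close>. Either they are linearly dependent, and \<open>P\<close> lies on a line,
  or \<open>1\<close>, \<open>y/x\<close>, \<open>(y/x)\<^sup>2\<close> are independent and \<open>z/x\<close> is a quadratic polynomial in \<open>y/x\<close>, so that \<open>P\<close> lies
  on a conic over \<open>K\<close> that is the projective closure of a graph. In both cases the base change to \<open>Y\<close> is
  parametrized by \<open>L[t]\<close>, hence integral, and it is invariant since its equation has
  coefficients in \<open>K\<close>. Division by the equation gives the Hilbert function \<open>d * n + 1\<close>, from which
  both the degree and the dimension follow. No subvariety has degree \<open>0\<close>.\<close>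

subsection \<open>Homogeneous components\<close>

text \<open>Irreducibility over \<open>K\<close> need not survive the passage to \<open>L\<close>:
  in characteristic three, \<open>x ^ 3 - c * y ^ 3\<close> becomes a cube once \<open>c\<close> has
  a cube root. The curve is therefore chosen so that its equation stays prime over every field: it
  is a graph, and its ideal is the kernel of a homomorphism into a polynomial ring. This dictates
  the forms \<open>x * x\<close>, \<open>x * y\<close>, \<open>y * y\<close>, \<open>x * z\<close>:
  they are four against dimension three, and \<open>z\<close> occurs only linearly. The delicate
  point is that the coefficients of \<open>y * y\<close> and \<open>x * z\<close> are both nonzero;
  an explicit conjugate replaces the theory of degrees of field extensions there. Invariance and
  dimension are defined through local derivations and chains of homogeneous primes, not through
  equations. Both are reduced to the fact that the ideal over \<open>L\<close> is generated by one
  form with coefficients in \<open>K\<close>, which division with remainder supplies.\<close>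

abbreviation total_degree :: "('v::finite \<Rightarrow>\<^sub>0 nat) \<Rightarrow> nat" where
  "total_degree m \<equiv> \<Sum>i\<in>UNIV. Poly_Mapping.lookup m i"

abbreviation var :: "'v \<Rightarrow> ('v, 'k::field) mpoly" where
  "var i \<equiv> Poly_Mapping.single (Poly_Mapping.single i 1) 1"

lemma mpoly_sum_singles:
  fixes f :: "'a \<Rightarrow>\<^sub>0 'b::comm_monoid_add"
  shows "f = (\<Sum>m\<in>Poly_Mapping.keys f. Poly_Mapping.single m (Poly_Mapping.lookup f m))"
proof (rule poly_mapping_eqI)
  fix k
  have "Poly_Mapping.lookup (\<Sum>m\<in>Poly_Mapping.keys f. Poly_Mapping.single m (Poly_Mapping.lookup f m)) k
     = (\<Sum>m\<in>Poly_Mapping.keys f. if m = k then Poly_Mapping.lookup f m else 0)"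
    by (simp add: lookup_sum lookup_single when_def)
  also have "\<dots> = Poly_Mapping.lookup f k"
    by (simp add: in_keys_iff)
  finally show "Poly_Mapping.lookup f k = Poly_Mapping.lookup (\<Sum>m\<in>Poly_Mapping.keys f.
      Poly_Mapping.single m (Poly_Mapping.lookup f m)) k" by simp
qed

lemma mpoly_induct [case_names single add]:
  fixes f :: "'a \<Rightarrow>\<^sub>0 'b::comm_monoid_add"
  assumes "\<And>m c. Q (Poly_Mapping.single m c)" and "\<And>f g. Q f \<Longrightarrow> Q g \<Longrightarrow> Q (f + g)"
  shows "Q f"
proof -
  have "Q (\<Sum>m\<in>S. Poly_Mapping.single m (Poly_Mapping.lookup f m))" if "finite S" for S
    using that
  proof (induction S)
    case empty
    show ?case using assms(1)[of undefined 0] by simp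
  next
    case (insert m S)
    then show ?case using assms by simp
  qed
  from this[of "Poly_Mapping.keys f"] show ?thesis
    using mpoly_sum_singles[of f] by simp
qed

text \<open>Both sides are biadditive, so comparison on single terms suffices. It serves the
  substitution \<open>param\<close> as well as the map of coefficients along \<iota>.\<close>

lemma multiplicative_from_singles:
  fixes T :: "('a::monoid_add \<Rightarrow>\<^sub>0 'b::semiring_0) \<Rightarrow> 'c::semiring_0"
  assumes add: "\<And>f g. T (f + g) = T f + T g"
    and single: "\<And>m a n b. T (Poly_Mapping.single (m + n) (a * b)) =
      T (Poly_Mapping.single m a) * T (Poly_Mapping.single n b)"
  shows "T (f * g) = T f * T g"
proof (induction f rule: mpoly_induct)
  case (single m a)
  show ?case
  proof (induction g rule: mpoly_induct)
    case (single n b)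
    show ?case by (simp add: mult_single assms(2))
  next
    case (add g h)
    then show ?case by (simp add: distrib_left assms(1))
  qed
next
  case (add f h)
  then show ?case by (simp add: distrib_right assms(1))
qed

lemma total_degree_add:
  "total_degree (m + n) = total_degree m + total_degree n"
  by (simp add: lookup_add sum.distrib)

lemma total_degree_single [simp]:
  "total_degree (Poly_Mapping.single i k) = k"
  by (simp add: lookup_single when_def)

lemma homogeneousI:
  assumes "\<And>m. Poly_Mapping.lookup f m \<noteq> 0 \<Longrightarrow> total_degree m = n"
  shows "homogeneous n f"
  using assms by (auto simp: homogeneous_def in_keys_iff)

lemma homogeneousD:
  assumes "homogeneous n f" "Poly_Mapping.lookup f m \<noteq> 0"
  shows "total_degree m = n"
  using assms by (auto simp: homogeneous_def in_keys_iff)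

lemma homogeneous_0 [simp]: "homogeneous n 0"
  by (simp add: homogeneous_def)

lemma homogeneous_single [simp]: "total_degree m = n \<Longrightarrow> homogeneous n (Poly_Mapping.single m c)"
  by (auto simp: homogeneous_def)

lemma homogeneous_add:
  assumes "homogeneous n f" "homogeneous n g" shows "homogeneous n (f + g)"
  by (rule homogeneousI) (metis add_0 assms homogeneousD lookup_add)

lemma homogeneous_sum:
  assumes "\<And>i. i \<in> S \<Longrightarrow> homogeneous n (f i)" shows "homogeneous n (sum f S)"
  using assms by (induction S rule: infinite_finite_induct) (auto intro: homogeneous_add)

lemma homogeneous_mult:
  assumes "homogeneous n f" "homogeneous k g" shows "homogeneous (n + k) (f * g)"
proof -
  have "total_degree m = n + k" if "m \<in> Poly_Mapping.keys (f * g)" for m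
  proof -
    obtain a b where "m = a + b" "a \<in> Poly_Mapping.keys f" "b \<in> Poly_Mapping.keys g"
      using keys_mult[of f g] \<open>m \<in> _\<close> by blast
    then show ?thesis using assms by (simp add: homogeneous_def total_degree_add)
  qed
  then show ?thesis by (simp add: homogeneous_def)
qed

lemma homogeneous_scalar [simp]: "homogeneous 0 (scalar c)"
  by (simp add: scalar_def)

lemma homogeneous_scalar_mult:
  assumes "homogeneous n f" shows "homogeneous n (scalar c * f)"
  using homogeneous_mult[OF homogeneous_scalar assms] by simp

lemma homogeneous_var: "homogeneous 1 (var i)"
  by simp

lemma homogeneous_1 [simp]: "homogeneous 0 1"
  by (simp add: homogeneous_def)

lemma homogeneous_uminus: "homogeneous n f \<Longrightarrow> homogeneous n (- f)"
  by (rule homogeneousI) (simp add: homogeneousD)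

lemma homogeneous_diff:
  "homogeneous n f \<Longrightarrow> homogeneous n g \<Longrightarrow> homogeneous n (f - g)"
  using homogeneous_add[of n f "- g"] by (simp add: homogeneous_uminus)

lemma homogeneous_power:
  assumes "homogeneous n f" shows "homogeneous (n * k) (f ^ k)"
  by (induction k) (simp_all add: homogeneous_mult[OF assms])

lemma homogeneous_var_power: "homogeneous k (var i ^ k)"
  using homogeneous_power[OF homogeneous_var, of k] by simp

lemma lookup_hom_component:
  "Poly_Mapping.lookup (hom_component n f) m =
     (if total_degree m = n then Poly_Mapping.lookup f m else 0)"
proof -
  have "finite {k \<in> Poly_Mapping.keys f. total_degree k = n}" by simp
  then show ?thesis
    by (simp add: hom_component_def lookup_sum lookup_single when_def in_keys_iff)
qed

lemma homogeneous_hom_component [simp]: "homogeneous n (hom_component n f)"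
  by (rule homogeneousI) (simp add: lookup_hom_component split: if_splits)

lemma hom_component_add: "hom_component n (f + g) = hom_component n f + hom_component n g"
  by (rule poly_mapping_eqI) (simp add: lookup_hom_component lookup_add)

lemma hom_component_0 [simp]: "hom_component n 0 = 0"
  by (rule poly_mapping_eqI) (simp add: lookup_hom_component)

lemma hom_component_homogeneous:
  assumes "homogeneous n f"
  shows "hom_component k f = (if k = n then f else 0)"
  by (rule poly_mapping_eqI) (use assms homogeneousD in \<open>auto simp: lookup_hom_component\<close>)

lemma hom_component_mult:
  assumes "homogeneous k F"
  shows "hom_component n (F * g) = (if k \<le> n then F * hom_component (n - k) g else 0)"
proof (induction g rule: mpoly_induct)
  case (single m c)
  have 1: "homogeneous (k + total_degree m) (F * Poly_Mapping.single m c)"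
    using assms by (intro homogeneous_mult) auto
  have 2: "homogeneous (total_degree m) (Poly_Mapping.single m c)" by simp
  show ?case
    by (auto simp: hom_component_homogeneous[OF 1] hom_component_homogeneous[OF 2])
next
  case (add g h)
  then show ?case by (simp add: distrib_left hom_component_add)
qed

lemma sum_hom_components:
  "f = (\<Sum>n\<in>total_degree ` Poly_Mapping.keys f. hom_component n f)"
proof (rule poly_mapping_eqI)
  fix m
  show "Poly_Mapping.lookup f m = Poly_Mapping.lookup
      (\<Sum>n\<in>total_degree ` Poly_Mapping.keys f. hom_component n f) m"
    by (auto simp: lookup_sum lookup_hom_component in_keys_iff)
qed

subsection \<open>Homogeneous ideals and points\<close>

lemma homogeneous_idealD:
  assumes "homogeneous_ideal I"
  shows "0 \<in> I" "f \<in> I \<Longrightarrow> g \<in> I \<Longrightarrow> f + g \<in> I" "f \<in> I \<Longrightarrow> h * f \<in> I"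
    "f \<in> I \<Longrightarrow> f * h \<in> I" "f \<in> I \<Longrightarrow> hom_component n f \<in> I"
    "f \<in> I \<Longrightarrow> g \<in> I \<Longrightarrow> f - g \<in> I"
proof -
  show "0 \<in> I" "f \<in> I \<Longrightarrow> g \<in> I \<Longrightarrow> f + g \<in> I" "f \<in> I \<Longrightarrow> h * f \<in> I"
    "f \<in> I \<Longrightarrow> f * h \<in> I" "f \<in> I \<Longrightarrow> hom_component n f \<in> I"
    using assms by (auto simp: homogeneous_ideal_def mult.commute[of f h])
  show "f \<in> I \<Longrightarrow> g \<in> I \<Longrightarrow> f - g \<in> I"
  proof -
    assume "f \<in> I" "g \<in> I"
    then have "f + (- 1) * g \<in> I"
      using assms unfolding homogeneous_ideal_def by blast
    then show ?thesis by simp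
  qed
qed

lemma homogeneous_ideal_sum:
  assumes "homogeneous_ideal I" "\<And>i. i \<in> S \<Longrightarrow> f i \<in> I"
  shows "sum f S \<in> I"
  using assms(2)
  by (induction S rule: infinite_finite_induct) (auto simp: homogeneous_idealD[OF assms(1)])

lemma homogeneous_ideal_cancel:
  assumes "homogeneous_ideal I" "f + g \<in> I" "g \<in> I"
  shows "f \<in> I"
  using homogeneous_idealD(6)[OF assms] by simp

lemma proj_pointsD:
  assumes "p \<in> proj_points"
  shows "homogeneous_ideal p" "1 \<notin> p" "f * g \<in> p \<Longrightarrow> f \<in> p \<or> g \<in> p"
  using assms by (auto simp: proj_points_def)

lemma proj_points_power:
  assumes "p \<in> proj_points" "f \<notin> p"
  shows "f ^ n \<notin> p"
proof (induction n)
  case 0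
  show ?case using proj_pointsD(2)[OF assms(1)] by simp
next
  case (Suc n)
  then show ?case using proj_pointsD(3)[OF assms(1), of f "f ^ n"] assms(2) by auto
qed

text \<open>Every monomial other than 1 is a multiple of a variable, so the variables generate the
  irrelevant ideal. A variable outside a point later provides a chart and denominators.\<close>

lemma not_irrelevant_subset_iff:
  fixes p :: "('v::finite, 'k::field) mpoly set"
  assumes "homogeneous_ideal p"
  shows "\<not> irrelevant_ideal \<subseteq> p \<longleftrightarrow> (\<exists>i. var i \<notin> p)"
proof
  assume "\<exists>i. var i \<notin> p"
  then obtain i where i: "(var i :: ('v, 'k) mpoly) \<notin> p" ..
  have "Poly_Mapping.single i (1::nat) \<noteq> 0"
    by (metis lookup_single_eq lookup_zero zero_neq_one)
  then have "var i \<in> irrelevant_ideal"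
    by (simp add: irrelevant_ideal_def lookup_single)
  with i show "\<not> irrelevant_ideal \<subseteq> p" by blast
next
  assume not: "\<not> irrelevant_ideal \<subseteq> p"
  show "\<exists>i. var i \<notin> p"
  proof (rule ccontr)
    assume "\<nexists>i. var i \<notin> p"
    then have all: "var i \<in> p" for i by blast
    have "f \<in> p" if f: "f \<in> irrelevant_ideal" for f :: "('v, 'k) mpoly"
    proof -
      have "Poly_Mapping.single m (Poly_Mapping.lookup f m) \<in> p" if "m \<in> Poly_Mapping.keys f" for m
      proof -
        have "m \<noteq> 0"
          using f that by (auto simp: irrelevant_ideal_def in_keys_iff)
        then obtain i where i: "Poly_Mapping.lookup m i \<noteq> 0"
          by (metis lookup_zero poly_mapping_eqI)
        have "m = (m - Poly_Mapping.single i 1) + Poly_Mapping.single i 1"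
          by (rule poly_mapping_eqI) (use i in \<open>auto simp: lookup_add lookup_minus lookup_single when_def\<close>)
        then have "Poly_Mapping.single m (Poly_Mapping.lookup f m) =
            Poly_Mapping.single (m - Poly_Mapping.single i 1) (Poly_Mapping.lookup f m) * var i"
          by (simp add: mult_single)
        then show ?thesis using homogeneous_idealD(3)[OF assms all] by simp
      qed
      then have "(\<Sum>m\<in>Poly_Mapping.keys f. Poly_Mapping.single m (Poly_Mapping.lookup f m)) \<in> p"
        by (intro homogeneous_ideal_sum[OF assms])
      then show ?thesis using mpoly_sum_singles[of f] by simp
    qed
    with not show False by blast
  qed
qed

lemma proj_pointsI:
  assumes "homogeneous_ideal p" "\<And>f g. f * g \<in> p \<Longrightarrow> f \<in> p \<or> g \<in> p" "var i \<notin> p"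
  shows "p \<in> proj_points"
proof -
  have "1 \<notin> p"
    using homogeneous_idealD(3)[OF assms(1), of 1 "var i"] assms(3) by auto
  then show ?thesis
    using assms not_irrelevant_subset_iff[OF assms(1)] by (auto simp: proj_points_def)
qed

lemma proj_points_var:
  assumes "p \<in> proj_points" obtains i where "var i \<notin> p"
  using assms not_irrelevant_subset_iff[OF proj_pointsD(1)[OF assms]]
  by (auto simp: proj_points_def)

lemma homogeneous_ideal_subsetI:
  assumes "homogeneous_ideal I" "homogeneous_ideal J"
    and "\<And>n f. f \<in> I \<Longrightarrow> homogeneous n f \<Longrightarrow> f \<in> J"
  shows "I \<subseteq> J"
proof
  fix f assume "f \<in> I"
  then have "(\<Sum>n\<in>total_degree ` Poly_Mapping.keys f. hom_component n f) \<in> J"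
    using assms(3) homogeneous_idealD(5)[OF assms(1)]
    by (intro homogeneous_ideal_sum[OF assms(2)]) (metis homogeneous_hom_component)
  then show "f \<in> J" using sum_hom_components[of f] by simp
qed

subsection \<open>Linear dependence modulo a subspace\<close>

text \<open>Gaussian elimination: a pivot \<open>u j0 i\<close> removes the unknown
  \<open>j0\<close> together with the equation \<open>i\<close>, so the surplus of unknowns is
  kept.\<close>

lemma linear_system_nontrivial_solution:
  fixes u :: "'j \<Rightarrow> 'i \<Rightarrow> 'k::field"
  assumes "finite I" "finite J" "card I < card J"
  shows "\<exists>c. (\<exists>j\<in>J. c j \<noteq> 0) \<and> (\<forall>i\<in>I. (\<Sum>j\<in>J. c j * u j i) = 0)"
  using assms
proof (induction I arbitrary: J u rule: finite_induct)
  case empty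
  then have "J \<noteq> {}" by auto
  then show ?case by (intro exI[of _ "\<lambda>_. 1"]) auto
next
  case (insert i I)
  show ?case
  proof (cases "\<forall>j\<in>J. u j i = 0")
    case True
    have "card I < card J" using insert by simp
    from insert.IH[OF insert.prems(1) this, of u] show ?thesis using True by auto
  next
    case False
    then obtain j0 where j0: "j0 \<in> J" "u j0 i \<noteq> 0" by blast
    define J' where "J' = J - {j0}"
    have J: "J = insert j0 J'" "j0 \<notin> J'" "finite J'" using j0 insert by (auto simp: J'_def)
    have "card I < card J'" using insert J by simp
    from insert.IH[OF J(3) this, of "\<lambda>j k. u j k - u j i / u j0 i * u j0 k"]
    obtain c where c: "\<exists>j\<in>J'. c j \<noteq> 0"
      "\<And>k. k \<in> I \<Longrightarrow> (\<Sum>j\<in>J'. c j * (u j k - u j i / u j0 i * u j0 k)) = 0" by blast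
    \<comment> \<open>The value \<open>- e\<close> for the unknown \<open>j0\<close> is the one that
      equation \<open>i\<close> forces.\<close>
    define e where "e = (\<Sum>j\<in>J'. c j * u j i) / u j0 i"
    define c' where "c' = c(j0 := - e)"
    have sum: "(\<Sum>j\<in>J. c' j * u j k) = - e * u j0 k + (\<Sum>j\<in>J'. c j * u j k)" for k
    proof -
      have "(\<Sum>j\<in>J'. c' j * u j k) = (\<Sum>j\<in>J'. c j * u j k)"
        using J by (intro sum.cong) (auto simp: c'_def)
      then show ?thesis using J by (simp add: c'_def)
    qed
    have "(\<Sum>j\<in>J. c' j * u j k) = 0" if "k \<in> I" for k
    proof -
      have "0 = (\<Sum>j\<in>J'. c j * u j k - c j * u j i / u j0 i * u j0 k)"
        using c(2)[OF that] by (simp add: algebra_simps)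
      also have "\<dots> = (\<Sum>j\<in>J'. c j * u j k) - e * u j0 k"
        by (simp add: sum_subtractf e_def sum_divide_distrib sum_distrib_right)
      finally show ?thesis by (simp add: sum)
    qed
    moreover have "(\<Sum>j\<in>J. c' j * u j i) = 0"
      using j0 by (simp add: sum e_def)
    moreover have "\<exists>j\<in>J. c' j \<noteq> 0" using c(1) J by (auto simp: c'_def)
    ultimately show ?thesis by blast
  qed
qed

text \<open>Since \<open>B\<close> spans \<open>V\<close> modulo \<open>W\<close>, expanding each
  \<open>u j\<close> in it gives \<open>d\<close> equations in more than \<open>d\<close> unknowns;
  a nontrivial solution cancels all the \<open>B\<close>-parts.\<close>

lemma quotient_dim_dependent:
  assumes "vector_space s" "module.subspace s W" "quotient_dim s V W d"
    and "finite J" "d < card J" "\<And>j. j \<in> J \<Longrightarrow> u j \<in> V"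
  shows "\<exists>c. (\<exists>j\<in>J. c j \<noteq> 0) \<and> (\<Sum>j\<in>J. s (c j) (u j)) \<in> W"
proof -
  interpret vector_space s by fact
  obtain B where B: "finite B" "card B = d"
    and ex: "\<And>v. v \<in> V \<Longrightarrow> \<exists>c. v - (\<Sum>b\<in>B. s (c b) b) \<in> W"
  proof -
    from assms(3) obtain B where "finite B" "card B = d"
      and "\<forall>v\<in>V. \<exists>!c. c \<in> B \<rightarrow>\<^sub>E UNIV \<and> v - (\<Sum>b\<in>B. s (c b) b) \<in> W"
      unfolding quotient_dim_def by (elim exE conjE)
    then show thesis by (intro that[of B]) (auto dest!: bspec ex1_implies_ex)
  qed
  define a where "a j = (SOME c. u j - (\<Sum>b\<in>B. s (c b) b) \<in> W)" for j
  have a: "u j - (\<Sum>b\<in>B. s (a j b) b) \<in> W" if "j \<in> J" for j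
    unfolding a_def using someI_ex[OF ex[OF assms(6)[OF that]]] .
  obtain c where c: "\<exists>j\<in>J. c j \<noteq> 0" "\<And>b. b \<in> B \<Longrightarrow> (\<Sum>j\<in>J. c j * a j b) = 0"
    using linear_system_nontrivial_solution[OF B(1) assms(4), of a] B(2) assms(5) by blast
  have "(\<Sum>j\<in>J. s (c j) (u j)) = (\<Sum>j\<in>J. s (c j) (u j - (\<Sum>b\<in>B. s (a j b) b)))
      + (\<Sum>j\<in>J. \<Sum>b\<in>B. s (c j * a j b) b)"
    by (simp add: scale_right_diff_distrib sum_subtractf scale_sum_right)
  also have "(\<Sum>j\<in>J. \<Sum>b\<in>B. s (c j * a j b) b) = (\<Sum>b\<in>B. s (\<Sum>j\<in>J. c j * a j b) b)"
    by (subst sum.swap) (simp add: scale_sum_left)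
  also have "\<dots> = 0" using c(2) by simp
  finally have "(\<Sum>j\<in>J. s (c j) (u j)) = (\<Sum>j\<in>J. s (c j) (u j - (\<Sum>b\<in>B. s (a j b) b)))"
    by simp
  also have "\<dots> \<in> W"
    using a assms(2) by (intro subspace_sum subspace_scale) auto
  finally show ?thesis using c(1) by blast
qed

lemma scalar_simps:
  "scalar 0 = 0" "scalar 1 = 1" "scalar (a + b) = scalar a + scalar b"
  "scalar (a * b) = scalar a * scalar b" "scalar (- a) = - scalar a"
  "scalar (a - b) = scalar a - scalar b"
  by (simp_all add: scalar_def single_add mult_single single_uminus single_diff)

lemma vector_space_scalar_mult: "vector_space (\<lambda>c f. scalar c * f)"
  by unfold_locales (simp_all add: scalar_simps algebra_simps)

lemma vector_space_Fract_scalar_mult: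
  "vector_space (\<lambda>c \<phi>. Fract (scalar c :: ('v::{finite,linorder}, 'k::field) mpoly) 1 * \<phi>)"
proof -
  have add: "Fract (scalar (a + b)) 1 = Fract (scalar a :: ('v, 'k) mpoly) 1 + Fract (scalar b) 1"
    for a b :: 'k
    by (simp add: scalar_simps)
  have mult: "Fract (scalar (a * b)) 1 = Fract (scalar a :: ('v, 'k) mpoly) 1 * Fract (scalar b) 1"
    for a b :: 'k
    by (simp add: scalar_simps)
  have one: "Fract (scalar 1) 1 = (1 :: ('v, 'k) mpoly fract)"
    by (simp add: scalar_simps One_fract_def)
  show ?thesis
    by unfold_locales
      (simp_all only: add mult one distrib_left distrib_right mult.assoc mult_1_left)
qed

subsection \<open>Ideals of parametrized curves\<close>

abbreviation monomial_value :: "('v::finite \<Rightarrow> 'r::comm_semiring_1) \<Rightarrow> ('v \<Rightarrow>\<^sub>0 nat) \<Rightarrow> 'r" where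
  "monomial_value p m \<equiv> \<Prod>i\<in>UNIV. p i ^ Poly_Mapping.lookup m i"

lemma monomial_value_add:
  "monomial_value p (m + n) = monomial_value p m * monomial_value p n"
  by (simp add: lookup_add power_add prod.distrib)

lemma monomial_value_single: "monomial_value p (Poly_Mapping.single i k) = p i ^ k"
proof -
  have "monomial_value p (Poly_Mapping.single i k) = (\<Prod>j\<in>UNIV. if j = i then p i ^ k else 1)"
    by (intro prod.cong) (auto simp: lookup_single)
  then show ?thesis by simp
qed

text \<open>The substitution of \<open>p i * s\<close> for the \<open>i\<close>-th variable. The outer variable \<open>s\<close> records the
  degree, so that the kernel is a homogeneous ideal.\<close>

definition param :: "('v::finite \<Rightarrow> 'l::field poly) \<Rightarrow> ('v, 'l) mpoly \<Rightarrow> 'l poly poly" where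
  "param p f = (\<Sum>m\<in>Poly_Mapping.keys f.
     monom (smult (Poly_Mapping.lookup f m) (monomial_value p m)) (total_degree m))"

lemma param_superset:
  assumes "finite S" "Poly_Mapping.keys f \<subseteq> S"
  shows "param p f = (\<Sum>m\<in>S.
     monom (smult (Poly_Mapping.lookup f m) (monomial_value p m)) (total_degree m))"
  unfolding param_def using assms
  by (intro sum.mono_neutral_left) (auto simp: in_keys_iff)

lemma param_add: "param p (f + g) = param p f + param p g"
proof -
  let ?S = "Poly_Mapping.keys f \<union> Poly_Mapping.keys g"
  have S: "finite ?S" by simp
  have "param p (f + g) = (\<Sum>m\<in>?S.
     monom (smult (Poly_Mapping.lookup (f + g) m) (monomial_value p m)) (total_degree m))"
    by (rule param_superset[OF S keys_add])
  then show ?thesis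
    by (simp add: param_superset[OF S, of f] param_superset[OF S, of g] lookup_add
        smult_add_left sum.distrib flip: add_monom)
qed

lemma param_single:
  "param p (Poly_Mapping.single m c) = monom (smult c (monomial_value p m)) (total_degree m)"
  by (subst param_superset[of "{m}"]) auto

lemma param_mult: "param p (f * g) = param p f * param p g"
  by (rule multiplicative_from_singles)
    (simp_all add: param_add param_single monomial_value_add total_degree_add mult_monom mult.commute)

lemma param_0 [simp]: "param p 0 = 0"
  by (simp add: param_def)

lemma param_scalar: "param p (scalar c) = [:[:c:]:]"
  by (simp add: scalar_def param_single monom_0)

lemma param_var: "param p (var i) = monom (p i) 1"
  by (simp only: param_single monomial_value_single total_degree_single power_one_right smult_1_left)

lemma param_hom_component: "param p (hom_component n f) = monom (coeff (param p f) n) n"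
proof (induction f rule: mpoly_induct)
  case (single m c)
  have "homogeneous (total_degree m) (Poly_Mapping.single m c)" by simp
  from hom_component_homogeneous[OF this, of n] show ?case
    by (auto simp: param_single)
next
  case (add f g)
  then show ?case by (simp add: hom_component_add param_add add_monom)
qed

definition curve_ideal :: "('v::finite \<Rightarrow> 'l::field poly) \<Rightarrow> ('v, 'l) mpoly set" where
  "curve_ideal p = {f. param p f = 0}"

lemma homogeneous_ideal_curve_ideal: "homogeneous_ideal (curve_ideal p)"
  by (simp add: homogeneous_ideal_def curve_ideal_def param_add param_mult param_hom_component)

text \<open>The kernel of a homomorphism into the integral domain \<open>'l poly poly\<close> is
  prime, and the variable \<open>i\<close> is not in it.\<close>

lemma curve_ideal_proj_points:
  assumes "p i \<noteq> 0" shows "curve_ideal p \<in> proj_points"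
proof (rule proj_pointsI)
  show "homogeneous_ideal (curve_ideal p)" by (rule homogeneous_ideal_curve_ideal)
  show "f \<in> curve_ideal p \<or> g \<in> curve_ideal p" if "f * g \<in> curve_ideal p" for f g
    using that by (simp add: curve_ideal_def param_mult)
  show "var i \<notin> curve_ideal p"
    using assms by (simp add: curve_ideal_def param_var del: One_nat_def)
qed

text \<open>Among the terms with nonzero coefficient exactly one reaches the maximal degree
  \<open>N\<close>, so its leading coefficient cannot be cancelled.\<close>

lemma distinct_degrees_independent:
  fixes P :: "'a \<Rightarrow> 'l::field poly"
  assumes "finite S" "inj_on (\<lambda>m. degree (P m)) S" "\<And>m. m \<in> S \<Longrightarrow> P m \<noteq> 0"
    and "(\<Sum>m\<in>S. smult (c m) (P m)) = 0" "m \<in> S"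
  shows "c m = 0"
proof (rule ccontr)
  assume "c m \<noteq> 0"
  define T where "T = {k \<in> S. c k \<noteq> 0}"
  have T: "finite T" "T \<noteq> {}" using assms \<open>c m \<noteq> 0\<close> by (auto simp: T_def)
  define N where "N = Max ((\<lambda>k. degree (P k)) ` T)"
  have "N \<in> (\<lambda>k. degree (P k)) ` T" unfolding N_def using T by (intro Max_in) auto
  then obtain k where k: "k \<in> T" "N = degree (P k)" by blast
  have le: "degree (P j) \<le> N" if "j \<in> T" for j
    unfolding N_def using T that by (intro Max_ge) auto
  have "coeff (\<Sum>m\<in>S. smult (c m) (P m)) N = (\<Sum>j\<in>S. if j = k then c k * coeff (P k) N else 0)"
    unfolding coeff_sum
  proof (intro sum.cong refl)
    fix j assume j: "j \<in> S"
    show "coeff (smult (c j) (P j)) N = (if j = k then c k * coeff (P k) N else 0)"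
    proof (cases "j = k \<or> c j = 0")
      case False
      then have "j \<in> T" using j by (simp add: T_def)
      moreover have "degree (P j) \<noteq> N"
        using False j k assms(2) by (auto simp: T_def dest: inj_onD)
      ultimately have "degree (P j) < N" using le[of j] by simp
      then show ?thesis using False by (simp add: coeff_eq_0)
    qed auto
  qed
  also have "\<dots> = c k * lead_coeff (P k)"
    using assms(1) k by (simp add: T_def)
  also have "\<dots> \<noteq> 0" using k assms(3) by (simp add: T_def)
  finally show False using assms(4) by simp
qed

text \<open>The form \<open>F\<close> of degree \<open>d\<close> is, up to a constant factor, monic in the variable \<open>v\<close>.
  The monomials of degree less than \<open>d\<close> in \<open>v\<close> have images of pairwise distinct degrees in \<open>t\<close>.\<close>

locale parametrized_curve =
  fixes p :: "'v::finite \<Rightarrow> 'l::field poly" and F :: "('v, 'l) mpoly" and v a b :: 'v and d :: nat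
  assumes d_pos: "0 < d"
    and homogeneous_F: "homogeneous d F"
    and lead_F: "Poly_Mapping.lookup F (Poly_Mapping.single v d) \<noteq> 0"
    and param_F: "param p F = 0"
    and degree_bij: "\<And>n. bij_betw (\<lambda>m. degree (monomial_value p m))
      {m. total_degree m = n \<and> Poly_Mapping.lookup m v < d} {0..d * n}"
    and monomial_value_nonzero: "\<And>m. Poly_Mapping.lookup m v < d \<Longrightarrow> monomial_value p m \<noteq> 0"
    and p_a: "coeff (p a) 0 \<noteq> 0"
    and p_b: "p b \<noteq> 0" "coeff (p b) 0 = 0"
begin

section \<open>Division with remainder by the form \<open>F\<close>\<close>

definition normal :: "('v, 'l) mpoly \<Rightarrow> bool" where
  "normal r \<longleftrightarrow> (\<forall>m\<in>Poly_Mapping.keys r. Poly_Mapping.lookup m v < d)"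

lemma normal_add: "normal r \<Longrightarrow> normal r' \<Longrightarrow> normal (r + r')"
  using keys_add[of r r'] by (auto simp: normal_def)

lemma normal_hom_component: "normal r \<Longrightarrow> normal (hom_component n r)"
  by (auto simp: normal_def in_keys_iff lookup_hom_component split: if_splits)

text \<open>Total degree \<open>d\<close> leaves no room for another variable once the exponent of
  \<open>v\<close> is \<open>d\<close>. Replacing the leading term of \<open>F\<close> by the
  remaining ones therefore lowers the exponent of \<open>v\<close>, which makes division
  terminate.\<close>

lemma lookup_F_v:
  assumes "Poly_Mapping.lookup F m \<noteq> 0" "m \<noteq> Poly_Mapping.single v d"
  shows "Poly_Mapping.lookup m v < d"
proof -
  have deg: "(\<Sum>i\<in>UNIV. Poly_Mapping.lookup m i) = d" using homogeneousD[OF homogeneous_F assms(1)] .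
  then have split: "Poly_Mapping.lookup m v + (\<Sum>i\<in>UNIV - {v}. Poly_Mapping.lookup m i) = d"
    by (simp add: sum.remove[of UNIV v])
  have "Poly_Mapping.lookup m v \<noteq> d"
  proof
    assume eq: "Poly_Mapping.lookup m v = d"
    then have "(\<Sum>i\<in>UNIV - {v}. Poly_Mapping.lookup m i) = 0" using split by simp
    then have "m = Poly_Mapping.single v d"
      using eq by (intro poly_mapping_eqI) (auto simp: lookup_single when_def)
    with assms(2) show False by simp
  qed
  with split show ?thesis by simp
qed

lemma division_single: "\<exists>h r. Poly_Mapping.single m c = F * h + r \<and> normal r"
proof (induction "Poly_Mapping.lookup m v" arbitrary: m c rule: less_induct)
  case less
  show ?case
  proof (cases "Poly_Mapping.lookup m v < d")
    case True
    then have "normal (Poly_Mapping.single m c)" by (simp add: normal_def)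
    then show ?thesis by (intro exI[of _ 0] exI[of _ "Poly_Mapping.single m c"]) simp
  next
    case False
    define k where "k = m - Poly_Mapping.single v d"
    have m: "m = Poly_Mapping.single v d + k"
      using False by (intro poly_mapping_eqI) (auto simp: k_def lookup_add lookup_minus lookup_single when_def)
    define l where "l = Poly_Mapping.lookup F (Poly_Mapping.single v d)"
    have l: "l \<noteq> 0" using lead_F by (simp add: l_def)
    define F' where "F' = F - Poly_Mapping.single (Poly_Mapping.single v d) l"
    \<comment> \<open>\<open>G\<close> is what remains after subtracting the multiple of
      \<open>F\<close> with leading term \<open>Poly_Mapping.single m c\<close>; its terms have
      smaller exponents of \<open>v\<close>.\<close>
    define G where "G = - (F' * Poly_Mapping.single k (c / l))"
    have F: "F = Poly_Mapping.single (Poly_Mapping.single v d) l + F'" by (simp add: F'_def)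
    have "F * Poly_Mapping.single k (c / l) = Poly_Mapping.single m c - G"
      by (subst F) (use l in \<open>simp add: distrib_right mult_single m G_def\<close>)
    then have eq: "Poly_Mapping.single m c = F * Poly_Mapping.single k (c / l) + G" by simp
    have small: "Poly_Mapping.lookup n v < Poly_Mapping.lookup m v" if n: "n \<in> Poly_Mapping.keys G" for n
    proof -
      have "n \<in> Poly_Mapping.keys (F' * Poly_Mapping.single k (c / l))"
        using n by (simp add: G_def in_keys_iff)
      then obtain e where e: "n = e + k" "e \<in> Poly_Mapping.keys F'"
        using keys_mult[of F' "Poly_Mapping.single k (c / l)"] by (auto split: if_splits)
      have ne: "e \<noteq> Poly_Mapping.single v d" using e by (auto simp: F'_def l_def in_keys_iff lookup_minus)
      then have "Poly_Mapping.lookup F e \<noteq> 0"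
        using e by (auto simp: F'_def in_keys_iff lookup_minus lookup_single)
      from lookup_F_v[OF this ne] show ?thesis by (simp add: e m lookup_add)
    qed
    \<comment> \<open>The induction hypothesis concerns single terms only, so \<open>G\<close> is
      divided term by term.\<close>
    have "\<exists>h r. (\<Sum>n\<in>S. Poly_Mapping.single n (Poly_Mapping.lookup G n)) = F * h + r \<and> normal r"
      if "finite S" "S \<subseteq> Poly_Mapping.keys G" for S
      using that
    proof (induction S)
      case empty
      show ?case by (intro exI[of _ 0]) (auto simp: normal_def)
    next
      case (insert n S)
      obtain h r where 1: "(\<Sum>n\<in>S. Poly_Mapping.single n (Poly_Mapping.lookup G n)) = F * h + r" "normal r"
        using insert by auto
      obtain h' r' where 2: "Poly_Mapping.single n (Poly_Mapping.lookup G n) = F * h' + r'" "normal r'"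
        using less[OF small[of n]] insert.prems by blast
      show ?case
        using 1 2 insert.hyps normal_add[of r r']
        by (intro exI[of _ "h + h'"] exI[of _ "r + r'"]) (simp add: algebra_simps)
    qed
    from this[OF finite_keys subset_refl] obtain h r where "G = F * h + r" "normal r"
      unfolding mpoly_sum_singles[of G, symmetric] by (elim exE conjE)
    then show ?thesis
      by (intro exI[of _ "Poly_Mapping.single k (c / l) + h"] exI[of _ r])
        (simp add: eq distrib_left add.assoc)
  qed
qed

lemma division: "\<exists>h r. g = F * h + r \<and> normal r"
proof (induction g rule: mpoly_induct)
  case (single m c)
  show ?case by (rule division_single)
next
  case (add f g)
  then obtain h r h' r' where "f = F * h + r" "g = F * h' + r'" "normal r" "normal r'" by blast
  then show ?case
    by (intro exI[of _ "h + h'"] exI[of _ "r + r'"]) (simp add: algebra_simps normal_add)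
qed

text \<open>All terms of a form of degree \<open>n\<close> go to the same power of the outer
  variable, so vanishing under \<open>param\<close> is a linear relation between the polynomials
  \<open>monomial_value p m\<close>, whose degrees differ.\<close>

lemma normal_homogeneous_eq_0:
  assumes "homogeneous n r" "normal r" "param p r = 0"
  shows "r = 0"
proof -
  have sum: "param p r =
      monom (\<Sum>m\<in>Poly_Mapping.keys r. smult (Poly_Mapping.lookup r m) (monomial_value p m)) n"
  proof -
    have "param p r = (\<Sum>m\<in>Poly_Mapping.keys r.
        monom (smult (Poly_Mapping.lookup r m) (monomial_value p m)) n)"
      unfolding param_def
      by (intro sum.cong refl) (use assms(1) in \<open>simp add: homogeneous_def\<close>)
    also have "(\<Sum>m\<in>S. monom (smult (Poly_Mapping.lookup r m) (monomial_value p m)) n) =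
        monom (\<Sum>m\<in>S. smult (Poly_Mapping.lookup r m) (monomial_value p m)) n" for S
      by (induction S rule: infinite_finite_induct) (simp_all add: add_monom)
    finally show ?thesis .
  qed
  have sub: "Poly_Mapping.keys r \<subseteq> {m. total_degree m = n \<and> Poly_Mapping.lookup m v < d}"
    using assms by (auto simp: homogeneous_def normal_def)
  have inj: "inj_on (\<lambda>m. degree (monomial_value p m)) (Poly_Mapping.keys r)"
    using inj_on_subset[OF bij_betw_imp_inj_on[OF degree_bij] sub] .
  have "Poly_Mapping.lookup r m = 0" if "m \<in> Poly_Mapping.keys r" for m
  proof (rule distinct_degrees_independent[OF finite_keys inj])
    show "(\<Sum>m\<in>Poly_Mapping.keys r. smult (Poly_Mapping.lookup r m) (monomial_value p m)) = 0"
      using sum assms(3) by simp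
  qed (use assms(2) that monomial_value_nonzero in \<open>auto simp: normal_def\<close>)
  then show ?thesis
    by (metis in_keys_iff lookup_zero poly_mapping_eqI)
qed

section \<open>The ideal of the curve as the principal ideal of \<open>F\<close>\<close>

abbreviation "Q \<equiv> curve_ideal p"

lemma Q_proj_points: "Q \<in> proj_points"
  by (rule curve_ideal_proj_points[of p b]) (rule p_b)

lemmas Q_ideal = homogeneous_idealD[OF homogeneous_ideal_curve_ideal[of p]]

lemma F_mult_in_Q: "F * h \<in> Q"
  by (simp add: curve_ideal_def param_mult param_F)

lemma normal_in_Q:
  assumes "normal r" "r \<in> Q" shows "r = 0"
proof -
  have "hom_component n r = 0" for n
    by (rule normal_homogeneous_eq_0[OF homogeneous_hom_component normal_hom_component[OF assms(1)]])
      (use Q_ideal(5)[OF assms(2), of n] in \<open>simp add: curve_ideal_def\<close>)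
  then show ?thesis using sum_hom_components[of r] by simp
qed

text \<open>The remainder of \<open>g\<close> on division by \<open>F\<close> is both normal and in
  \<open>Q\<close>, hence zero.\<close>

lemma Q_generated:
  assumes "g \<in> Q" obtains h where "g = F * h"
proof -
  obtain h r where g: "g = F * h + r" "normal r" using division by blast
  then have "r \<in> Q" using Q_ideal(6)[OF assms F_mult_in_Q[of h]] by simp
  then show thesis using that[of h] g normal_in_Q[of r] by simp
qed

text \<open>Taking the component of degree \<open>n\<close> makes the cofactor homogeneous. The
  disjunction \<open>h = 0 \<or> d \<le> n\<close> guards against truncation of \<open>n - d\<close>
  for a nonzero cofactor.\<close>

lemma Q_generated_homogeneous:
  assumes "g \<in> Q" "homogeneous n g"
  obtains h where "g = F * h" "homogeneous (n - d) h" "h = 0 \<or> d \<le> n"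
proof -
  obtain h where h: "g = F * h" using Q_generated[OF assms(1)] by blast
  have "g = hom_component n g" using assms(2) by (simp add: hom_component_homogeneous)
  also have "\<dots> = F * (if d \<le> n then hom_component (n - d) h else 0)"
    by (simp add: h hom_component_mult[OF homogeneous_F])
  finally show thesis using that by auto
qed

section \<open>Hilbert function and degree of the curve\<close>

definition basis :: "nat \<Rightarrow> ('v, 'l) mpoly set" where
  "basis n = (\<lambda>m. Poly_Mapping.single m 1) ` {m. total_degree m = n \<and> Poly_Mapping.lookup m v < d}"

lemma finite_normal_monomials: "finite {m. total_degree m = n \<and> Poly_Mapping.lookup m v < d}"
  using bij_betw_finite[OF degree_bij[of n]] by simp

lemma finite_basis: "finite (basis n)"
  using finite_normal_monomials by (simp add: basis_def)

lemma single_1_inj: "inj (\<lambda>m. Poly_Mapping.single m (1::'l))"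
  by (rule injI) (metis lookup_single_eq lookup_single_not_eq one_neq_zero)

lemma card_basis: "card (basis n) = d * n + 1"
  using bij_betw_same_card[OF degree_bij[of n]]
  by (simp add: basis_def card_image inj_on_subset[OF single_1_inj])

lemma basis_homogeneous: "x \<in> basis n \<Longrightarrow> homogeneous n x"
  by (auto simp: basis_def)

lemma lookup_basis_combination:
  assumes "total_degree m = n" "Poly_Mapping.lookup m v < d"
  shows "Poly_Mapping.lookup (\<Sum>x\<in>basis n. scalar (c x) * x) m = c (Poly_Mapping.single m 1)"
proof -
  have "(\<Sum>x\<in>basis n. scalar (c x) * x) =
     (\<Sum>k\<in>{m. total_degree m = n \<and> Poly_Mapping.lookup m v < d}.
        Poly_Mapping.single k (c (Poly_Mapping.single k 1)))"
    unfolding basis_def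
    by (subst sum.reindex) (simp_all add: inj_on_subset[OF single_1_inj] scalar_def mult_single)
  then show ?thesis
    using assms finite_normal_monomials[of n]
    by (simp add: lookup_sum lookup_single when_def)
qed

lemma lookup_basis_combination_0:
  assumes "\<not> (total_degree m = n \<and> Poly_Mapping.lookup m v < d)"
  shows "Poly_Mapping.lookup (\<Sum>x\<in>basis n. scalar (c x) * x) m = 0"
proof -
  have "Poly_Mapping.lookup (scalar (c x) * x) m = 0" if "x \<in> basis n" for x
    using that assms by (auto simp: basis_def scalar_def mult_single lookup_single when_def)
  then show ?thesis by (simp add: lookup_sum)
qed

lemma normal_basis_combination: "normal (\<Sum>x\<in>basis n. scalar (c x) * x)"
  unfolding normal_def in_keys_iff using lookup_basis_combination_0 by blast

lemma basis_combination_in_Q: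
  assumes "(\<Sum>x\<in>basis n. scalar (c x) * x) \<in> Q" "x \<in> basis n"
  shows "c x = 0"
proof -
  obtain m where m: "x = Poly_Mapping.single m 1" "total_degree m = n" "Poly_Mapping.lookup m v < d"
    using assms(2) by (auto simp: basis_def)
  have "(\<Sum>x\<in>basis n. scalar (c x) * x) = 0"
    by (rule normal_in_Q[OF normal_basis_combination assms(1)])
  then show ?thesis using lookup_basis_combination[OF m(2,3), of c] m(1) by simp
qed

lemma basis_combination_exists:
  assumes "homogeneous n f"
  shows "\<exists>c \<in> basis n \<rightarrow>\<^sub>E UNIV. f - (\<Sum>x\<in>basis n. scalar (c x) * x) \<in> Q"
proof -
  obtain h r where f: "f = F * h + r" "normal r" using division by blast
  define r' where "r' = hom_component n r"
  have r': "homogeneous n r'" "normal r'"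
    using f(2) by (simp_all add: r'_def normal_hom_component)
  have "f = hom_component n (F * h) + r'"
    using hom_component_homogeneous[OF assms, of n] by (simp add: f(1) hom_component_add r'_def)
  then have 1: "f - r' \<in> Q" using Q_ideal(5)[OF F_mult_in_Q, of n h] by simp
  \<comment> \<open>The coefficients are read off the normal remainder. The function is restricted
    because \<open>quotient_dim\<close> asks for a unique extensional one.\<close>
  define c where "c = (\<lambda>x\<in>basis n. Poly_Mapping.lookup r' (the_inv (\<lambda>m. Poly_Mapping.single m (1::'l)) x))"
  have "r' = (\<Sum>x\<in>basis n. scalar (c x) * x)"
  proof (rule poly_mapping_eqI)
    fix m
    show "Poly_Mapping.lookup r' m = Poly_Mapping.lookup (\<Sum>x\<in>basis n. scalar (c x) * x) m"
    proof (cases "total_degree m = n \<and> Poly_Mapping.lookup m v < d")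
      case True
      then have "Poly_Mapping.single m 1 \<in> basis n" by (auto simp: basis_def)
      then show ?thesis using True
        by (simp add: lookup_basis_combination c_def the_inv_f_f[OF single_1_inj])
    next
      case False
      have "Poly_Mapping.lookup r' m = 0"
      proof (rule ccontr)
        assume nz: "Poly_Mapping.lookup r' m \<noteq> 0"
        then have "Poly_Mapping.lookup m v < d" using r'(2) by (simp add: normal_def in_keys_iff)
        with False homogeneousD[OF r'(1) nz] show False by simp
      qed
      then show ?thesis using lookup_basis_combination_0[OF False, of c] by simp
    qed
  qed
  with 1 have "f - (\<Sum>x\<in>basis n. scalar (c x) * x) \<in> Q" by (simp only:)
  moreover have "c \<in> basis n \<rightarrow>\<^sub>E UNIV" by (simp add: c_def)
  ultimately show ?thesis by (rule bexI)
qed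

text \<open>Division by \<open>F\<close> gives existence of coordinates, and the vanishing of normal
  elements of \<open>Q\<close> gives uniqueness. As the count is exact in every degree, it serves
  the dimension argument as well as the Hilbert polynomial.\<close>

lemma quotient_dim_Q:
  "quotient_dim (\<lambda>c f. scalar c * f) {f. homogeneous n f} {f \<in> Q. homogeneous n f} (d * n + 1)"
  unfolding quotient_dim_def
proof (intro exI[of _ "basis n"] conjI ballI)
  show "basis n \<subseteq> {f. homogeneous n f}" using basis_homogeneous by blast
  show "finite (basis n)" "card (basis n) = d * n + 1" by (fact finite_basis card_basis)+
  fix f :: "('v, 'l) mpoly" assume "f \<in> {f. homogeneous n f}"
  then have f: "homogeneous n f" by simp
  have hom: "homogeneous n (\<Sum>x\<in>basis n. scalar (c x) * x)" for c
    by (intro homogeneous_sum homogeneous_scalar_mult basis_homogeneous)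
  obtain c where c: "c \<in> basis n \<rightarrow>\<^sub>E UNIV" "f - (\<Sum>x\<in>basis n. scalar (c x) * x) \<in> Q"
    using basis_combination_exists[OF f] by blast
  show "\<exists>!c. c \<in> basis n \<rightarrow>\<^sub>E UNIV \<and> f - (\<Sum>x\<in>basis n. scalar (c x) * x) \<in> {f \<in> Q. homogeneous n f}"
  proof (rule ex1I[of _ c])
    show "c \<in> basis n \<rightarrow>\<^sub>E UNIV \<and> f - (\<Sum>x\<in>basis n. scalar (c x) * x) \<in> {f \<in> Q. homogeneous n f}"
      using c homogeneous_diff[OF f hom] by simp
    fix c' assume c': "c' \<in> basis n \<rightarrow>\<^sub>E UNIV \<and>
      f - (\<Sum>x\<in>basis n. scalar (c' x) * x) \<in> {f \<in> Q. homogeneous n f}"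
    have "(\<Sum>x\<in>basis n. scalar (c' x - c x) * x) =
      (f - (\<Sum>x\<in>basis n. scalar (c x) * x)) - (f - (\<Sum>x\<in>basis n. scalar (c' x) * x))"
      by (simp add: scalar_simps left_diff_distrib sum_subtractf)
    also have "\<dots> \<in> Q" by (rule Q_ideal(6)) (use c c' in simp_all)
    finally have "c' x = c x" if "x \<in> basis n" for x
      using basis_combination_in_Q[of "\<lambda>x. c' x - c x" n] that by simp
    then show "c' = c"
      using c(1) conjunct1[OF c'] by (intro PiE_ext)
  qed
qed

lemma subvariety_degree_Q: "subvariety_degree Q d"
proof -
  have "hilbert_polynomial Q [:1, of_nat d:]"
    unfolding hilbert_polynomial_def
  proof (intro always_eventually allI exI conjI)
    show "quotient_dim (\<lambda>c f. scalar c * f) {f. homogeneous n f} {f \<in> Q. homogeneous n f} (d * n + 1)"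
      for n by (rule quotient_dim_Q)
    show "poly [:1, of_nat d:] (of_nat n) = (of_nat (d * n + 1) :: rat)" for n
      by (simp add: mult.commute)
  qed
  \<comment> \<open>For \<open>d = 0\<close> the polynomial would be constant; \<open>d_pos\<close>
    enters here.\<close>
  moreover have "degree [:1, of_nat d :: rat:] = 1" using d_pos by simp
  ultimately show ?thesis
    unfolding subvariety_degree_def by (intro exI[of _ "[:1, of_nat d:]"]) simp
qed

end

subsection \<open>Dimension of a parametrized curve\<close>

text \<open>Taking the constant coefficient is evaluation at \<open>t = 0\<close>, a ring
  homomorphism, and so it commutes with substitution.\<close>

lemma coeff_param_const:
  "coeff (param (\<lambda>i. [:coeff (p i) 0:]) f) n = [:coeff (coeff (param p f) n) 0:]"
proof (induction f rule: mpoly_induct)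
  case (single m c)
  have "(\<Prod>i\<in>S. [:coeff (p i) 0:] ^ Poly_Mapping.lookup m i) =
      [:coeff (\<Prod>i\<in>S. p i ^ Poly_Mapping.lookup m i) 0:]" for S
  proof (induction S rule: infinite_finite_induct)
    case (insert i S)
    have "[:coeff (p i) 0:] ^ k = [:coeff (p i ^ k) 0:]" for k
      by (induction k) (simp_all add: coeff_mult_0 pCons_one)
    with insert show ?case by (simp add: coeff_mult_0)
  qed (simp_all add: pCons_one)
  then show ?case by (simp add: param_single)
next
  case (add f g)
  then show ?case by (simp add: param_add)
qed

context parametrized_curve
begin

text \<open>The point of the curve at the parameter \<open>t = 0\<close>. Written as a curve ideal
  with constant coordinates, it is prime by the same argument as \<open>Q\<close>.\<close>

abbreviation "Q0 \<equiv> curve_ideal (\<lambda>i. [:coeff (p i) 0:])"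

lemma Q0_proj_points: "Q0 \<in> proj_points"
  by (rule curve_ideal_proj_points[of _ a]) (use p_a in simp)

text \<open>The variable \<open>b\<close> vanishes at \<open>t = 0\<close> but not along the whole
  curve, which makes the inclusion strict.\<close>

lemma Q_subset_Q0: "Q \<subset> Q0"
proof
  show "Q \<subseteq> Q0"
    using coeff_param_const[of p] by (auto simp: curve_ideal_def poly_eq_iff)
  have "var b \<in> Q0" "var b \<notin> Q"
    using p_b by (simp_all add: curve_ideal_def param_var del: One_nat_def)
  then show "Q \<noteq> Q0" by blast
qed

lemma homogeneous_diff_element:
  assumes "homogeneous_ideal I" "homogeneous_ideal J" "I \<subset> J"
  obtains n f where "f \<in> J" "f \<notin> I" "homogeneous n f"
  using homogeneous_ideal_subsetI[OF assms(2,1)] assms(3) by blast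

text \<open>Modulo \<open>p1\<close> the number of independent forms of a given degree is bounded, so
  the products of powers of \<open>h \<in> p2 - p1\<close> and of a variable \<open>x \<notin> p2\<close> are dependent modulo \<open>p1\<close>;
  cancelling \<open>h\<close> from the relation and reducing modulo \<open>p2\<close> yields a power of \<open>x\<close> in \<open>p2\<close>.\<close>

lemma no_chain_above_Q:
  assumes p1: "p1 \<in> proj_points" and p2: "p2 \<in> proj_points"
    and lt1: "Q \<subset> p1" and lt2: "p1 \<subset> p2"
  shows False
proof -
  note I1 = proj_pointsD(1)[OF p1] and I2 = proj_pointsD(1)[OF p2]
  obtain e g where g: "g \<in> p1" "g \<notin> Q" "homogeneous e g"
    using homogeneous_diff_element[OF homogeneous_ideal_curve_ideal I1 lt1] by metis
  obtain e' h where h: "h \<in> p2" "h \<notin> p1" "homogeneous e' h"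
    using homogeneous_diff_element[OF I1 I2 lt2] by metis
  obtain i where i: "var i \<notin> p2" using proj_points_var[OF p2] .
  define x :: "('v, 'l) mpoly" where "x = var i"
  \<comment> \<open>With this value the \<open>N + 1\<close> products \<open>w k\<close> and the
    \<open>d * e' * N + 1\<close> products of \<open>g\<close> with basis elements number
    \<open>d * n + 2\<close>, one more than the dimension in degree \<open>n\<close>.\<close>
  define N where "N = d * e"
  define n where "n = e' * N + e"
  define w where "w k = h ^ k * x ^ (e' * (N - k) + e)" for k
  \<comment> \<open>Multiples of \<open>g \<in> p1\<close> join the family, so that a relation
    modulo \<open>Q\<close> becomes a relation between the \<open>w k\<close> modulo
    \<open>p1\<close>; no dimension modulo \<open>p1\<close> itself has to be computed.\<close>
  define u where "u = case_sum w ((*) g)"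
  define J where "J = {..N} <+> basis (e' * N)"
  define W where "W = {f \<in> Q. homogeneous n f}"
  interpret V: vector_space "\<lambda>c (f :: ('v, 'l) mpoly). scalar c * f" by (rule vector_space_scalar_mult)
  have sub: "module.subspace (\<lambda>c (f :: ('v, 'l) mpoly). scalar c * f) W"
    unfolding V.subspace_def W_def
    by (auto intro: Q_ideal homogeneous_add homogeneous_scalar_mult)
  have fin: "finite J" by (simp add: J_def finite_basis)
  have card: "d * n + 1 < card J"
    by (simp add: J_def card_Plus finite_basis card_basis n_def N_def algebra_simps)
  have hom: "u j \<in> {f. homogeneous n f}" if "j \<in> J" for j
  proof -
    have "homogeneous n (w k)" if "k \<le> N" for k
    proof -
      have "homogeneous (e' * k + (e' * (N - k) + e)) (w k)"
        unfolding w_def x_def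
        by (intro homogeneous_mult homogeneous_power homogeneous_var_power h)
      moreover have "e' * k + (e' * (N - k) + e) = n"
        using that by (simp add: n_def flip: add.assoc distrib_left)
      ultimately show ?thesis by simp
    qed
    moreover have "homogeneous n (g * y)" if "y \<in> basis (e' * N)" for y
      using homogeneous_mult[OF g(3) basis_homogeneous[OF that]] by (simp add: n_def add.commute)
    ultimately show ?thesis using that by (auto simp: J_def u_def)
  qed
  have qd: "quotient_dim (\<lambda>c f. scalar c * f) {f. homogeneous n f} W (d * n + 1)"
    unfolding W_def by (rule quotient_dim_Q)
  obtain c where c: "\<exists>j\<in>J. c j \<noteq> 0" "(\<Sum>j\<in>J. scalar (c j) * u j) \<in> W"
  proof -
    have "\<exists>c. (\<exists>j\<in>J. c j \<noteq> 0) \<and> (\<Sum>j\<in>J. scalar (c j) * u j) \<in> W"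
      by (rule quotient_dim_dependent[OF vector_space_scalar_mult sub qd fin card]) (rule hom)
    then show thesis by (elim exE conjE) (rule that)
  qed
  define S1 where "S1 = (\<Sum>k\<le>N. scalar (c (Inl k)) * w k)"
  define S2 where "S2 = (\<Sum>y\<in>basis (e' * N). scalar (c (Inr y)) * y)"
  have "(\<Sum>j\<in>J. scalar (c j) * u j) = S1 + g * S2"
    unfolding J_def S1_def S2_def
    by (subst sum.Plus) (simp_all add: finite_basis u_def sum_distrib_left mult.left_commute)
  with c(2) have S: "S1 + g * S2 \<in> Q" by (simp add: W_def)
  show False
  proof (cases "\<exists>k\<le>N. c (Inl k) \<noteq> 0")
    case False
    \<comment> \<open>If only multiples of \<open>g\<close> occur, primality of \<open>Q\<close>
      cancels \<open>g\<close> and leaves a relation between basis elements, which is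
      trivial.\<close>
    then have "S1 = 0" by (simp add: S1_def scalar_simps)
    with S g(2) have "S2 \<in> Q"
      using proj_pointsD(3)[OF Q_proj_points, of g S2] by auto
    then have "c (Inr y) = 0" if "y \<in> basis (e' * N)" for y
      using basis_combination_in_Q[of "\<lambda>y. c (Inr y)" "e' * N" y] that by (simp add: S2_def)
    with c(1) False show False by (auto simp: J_def)
  next
    case True
    \<comment> \<open>The lowest power of \<open>h\<close> present is factored out and cancelled, as
      \<open>h\<close> is not in the prime \<open>p1\<close>. Every term after the first is then
      still a multiple of \<open>h \<in> p2\<close>.\<close>
    define k0 where "k0 = (LEAST k. k \<le> N \<and> c (Inl k) \<noteq> 0)"
    have k0: "k0 \<le> N" "c (Inl k0) \<noteq> 0"
      using LeastI_ex[OF True] by (simp_all add: k0_def)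
    have below: "c (Inl k) = 0" if "k < k0" for k
      using not_less_Least[of k "\<lambda>k. k \<le> N \<and> c (Inl k) \<noteq> 0"] that k0(1) by (auto simp: k0_def)
    define w' where "w' k = scalar (c (Inl k)) * (h ^ (k - k0) * x ^ (e' * (N - k) + e))" for k
    have "S1 = (\<Sum>k\<in>{k0..N}. scalar (c (Inl k)) * w k)"
      unfolding S1_def
      by (rule sum.mono_neutral_right) (auto simp: below scalar_simps not_le)
    also have "\<dots> = (\<Sum>k\<in>{k0..N}. h ^ k0 * w' k)"
    proof (rule sum.cong[OF refl])
      fix k assume "k \<in> {k0..N}"
      then have "h ^ k = h ^ k0 * h ^ (k - k0)" by (simp flip: power_add)
      then show "scalar (c (Inl k)) * w k = h ^ k0 * w' k"
        by (simp add: w_def w'_def mult_ac)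
    qed
    finally have S1: "S1 = h ^ k0 * (\<Sum>k\<in>{k0..N}. w' k)" by (simp add: sum_distrib_left)
    have "S1 \<in> p1"
      using S lt1 g(1) by (intro homogeneous_ideal_cancel[OF I1, of S1 "g * S2"])
        (auto intro: homogeneous_idealD(4)[OF I1])
    then have "(\<Sum>k\<in>{k0..N}. w' k) \<in> p1"
      using proj_pointsD(3)[OF p1, of "h ^ k0"] proj_points_power[OF p1 h(2), of k0]
      unfolding S1 by blast
    then have "(\<Sum>k\<in>{k0..N}. w' k) \<in> p2" using lt2 by blast
    moreover have "{k0..N} = insert k0 {k0<..N}" using k0(1) by auto
    ultimately have "w' k0 + (\<Sum>k\<in>{k0<..N}. w' k) \<in> p2" by simp
    moreover have "(\<Sum>k\<in>{k0<..N}. w' k) \<in> p2"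
    proof (rule homogeneous_ideal_sum[OF I2])
      fix k assume "k \<in> {k0<..N}"
      then have "k - k0 = Suc (k - k0 - 1)" by auto
      then have "h ^ (k - k0) = h * h ^ (k - k0 - 1)" by (metis power_Suc)
      then have "w' k = (scalar (c (Inl k)) * (h ^ (k - k0 - 1) * x ^ (e' * (N - k) + e))) * h"
        by (simp add: w'_def mult_ac)
      then show "w' k \<in> p2" using homogeneous_idealD(3)[OF I2 h(1)] by simp
    qed
    ultimately have "w' k0 \<in> p2" by (rule homogeneous_ideal_cancel[OF I2])
    then have "scalar (inverse (c (Inl k0))) * w' k0 \<in> p2" by (rule homogeneous_idealD(3)[OF I2])
    also have "scalar (inverse (c (Inl k0))) * w' k0 = x ^ (e' * (N - k0) + e)"
      using k0(2) by (simp add: w'_def scalar_simps flip: mult.assoc scalar_simps(4))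
    finally show False using proj_points_power[OF p2 i] by (simp add: x_def)
  qed
qed

lemma subvariety_dim_Q: "subvariety_dim Q 1"
  unfolding subvariety_dim_def
proof (intro conjI allI impI)
  show "\<exists>ps. specialization_chain Q ps \<and> length ps = 1 + 1"
    using Q_proj_points Q0_proj_points Q_subset_Q0
    by (intro exI[of _ "[Q, Q0]"]) (auto simp: specialization_chain_def)
next
  fix ps assume ps: "specialization_chain Q ps"
  show "length ps \<le> 1 + 1"
  proof (rule ccontr)
    assume "\<not> length ps \<le> 1 + 1"
    then obtain p0 p1 p2 ps' where "ps = p0 # p1 # p2 # ps'"
      by (cases ps; cases "tl ps"; cases "tl (tl ps)") auto
    with ps have "Q \<subseteq> p0" "p0 \<subset> p1" "p1 \<subset> p2" "p1 \<in> proj_points" "p2 \<in> proj_points"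
      by (auto simp: specialization_chain_def)
    with no_chain_above_Q[of p1 p2] show False by blast
  qed
qed

end

text \<open>For degree 0 the Hilbert polynomial is zero, so in some degree \<open>n\<close> every
  form lies in \<open>q\<close>, among them the \<open>n\<close>-th powers of all variables;
  primality then puts all variables into \<open>q\<close>.\<close>

lemma subvariety_degree_pos:
  assumes "q \<in> proj_points" "subvariety_degree q d"
  shows "0 < d"
proof (rule ccontr)
  assume "\<not> 0 < d"
  then obtain h where h: "hilbert_polynomial q h" "0 = fact (degree h) * lead_coeff h"
    using assms(2) by (auto simp: subvariety_degree_def)
  then have "h = 0" by simp
  with h obtain n where
    "quotient_dim (\<lambda>c f. scalar c * f) {f. homogeneous n f} {f \<in> q. homogeneous n f} 0"
    by (auto simp: hilbert_polynomial_def eventually_sequentially)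
  then have "f \<in> q" if "homogeneous n f" for f
    using that unfolding quotient_dim_def by (auto dest!: bspec ex1_implies_ex)
  then have "var i ^ n \<in> q" for i using homogeneous_var_power by blast
  then show False using proj_points_power[OF assms(1)] proj_points_var[OF assms(1)] by metis
qed

subsection \<open>Base change and invariance\<close>

context
  fixes \<iota> :: "'k::field \<Rightarrow> 'l::field"
  assumes \<iota>: "field_embedding \<iota>"
begin

lemma embedding_add: "\<iota> (a + b) = \<iota> a + \<iota> b"
  and embedding_mult: "\<iota> (a * b) = \<iota> a * \<iota> b"
  and embedding_1: "\<iota> 1 = 1"
  using \<iota> by (simp_all add: field_embedding_def)

lemma embedding_0: "\<iota> 0 = 0"
proof -
  have "\<iota> 0 + \<iota> 0 = \<iota> 0 + 0" using embedding_add[of 0 0] by (simp only: add.right_neutral)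
  then show ?thesis by (rule add_left_imp_eq)
qed

lemma embedding_eq_0_iff: "\<iota> a = 0 \<longleftrightarrow> a = 0"
proof
  assume "\<iota> a = 0"
  then have "\<iota> (a * inverse a) = 0" by (simp add: embedding_mult)
  then show "a = 0" using embedding_1 by (cases "a = 0") auto
qed (simp add: embedding_0)

lemma lookup_map_embedding: "Poly_Mapping.lookup (Poly_Mapping.map \<iota> f) m = \<iota> (Poly_Mapping.lookup f m)"
  by (simp add: map.rep_eq when_def embedding_0)

lemma map_embedding_single: "Poly_Mapping.map \<iota> (Poly_Mapping.single m c) = Poly_Mapping.single m (\<iota> c)"
  by (rule poly_mapping_eqI) (simp add: lookup_map_embedding lookup_single when_def embedding_0)

lemma map_embedding_add: "Poly_Mapping.map \<iota> (f + g) = Poly_Mapping.map \<iota> f + Poly_Mapping.map \<iota> g"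
  by (rule poly_mapping_eqI) (simp add: lookup_map_embedding lookup_add embedding_add)

lemma map_embedding_mult:
  "Poly_Mapping.map \<iota> (f * g :: 'a::monoid_add \<Rightarrow>\<^sub>0 'k) = Poly_Mapping.map \<iota> f * Poly_Mapping.map \<iota> g"
  by (rule multiplicative_from_singles) (simp_all only: map_embedding_add map_embedding_single embedding_mult mult_single)

lemma map_embedding_scalar: "Poly_Mapping.map \<iota> (scalar c) = scalar (\<iota> c)"
  by (simp add: scalar_def map_embedding_single)

lemma map_embedding_var: "Poly_Mapping.map \<iota> (var i) = var i"
  by (simp only: map_embedding_single embedding_1)

lemma map_embedding_power:
  "Poly_Mapping.map \<iota> (f ^ n :: 'a::monoid_add \<Rightarrow>\<^sub>0 'k) = Poly_Mapping.map \<iota> f ^ n"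
proof (induction n)
  case 0
  show ?case by (simp add: map_embedding_single embedding_1 flip: single_one)
qed (simp add: map_embedding_mult)

lemma homogeneous_map_embedding: "homogeneous n f \<Longrightarrow> homogeneous n (Poly_Mapping.map \<iota> f)"
  by (rule homogeneousI) (auto simp: lookup_map_embedding embedding_eq_0_iff homogeneousD)

lemma map_embedding_hom_component:
  "Poly_Mapping.map \<iota> (hom_component n f) = hom_component n (Poly_Mapping.map \<iota> f)"
  by (rule poly_mapping_eqI) (simp add: lookup_map_embedding lookup_hom_component embedding_0)

text \<open>The map of coefficients fixes the variables, so a variable outside \<open>p\<close>
  certifies that the preimage is again a point.\<close>

lemma base_change_proj_points:
  assumes p: "p \<in> proj_points"
  shows "base_change \<iota> p \<in> proj_points"
proof -
  obtain i where i: "var i \<notin> p" using proj_points_var[OF p] .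
  note I = homogeneous_idealD[OF proj_pointsD(1)[OF p]]
  show ?thesis
  proof (rule proj_pointsI)
    have zero: "Poly_Mapping.map \<iota> 0 = 0" by (rule poly_mapping_eqI) (simp add: lookup_map_embedding embedding_0)
    show "homogeneous_ideal (base_change \<iota> p)"
      unfolding homogeneous_ideal_def base_change_def
      by (auto simp: zero map_embedding_add map_embedding_mult map_embedding_hom_component I)
    show "f \<in> base_change \<iota> p \<or> g \<in> base_change \<iota> p" if "f * g \<in> base_change \<iota> p" for f g
      using that proj_pointsD(3)[OF p] by (simp add: base_change_def map_embedding_mult)
    show "var i \<notin> base_change \<iota> p" unfolding base_change_def mem_Collect_eq map_embedding_var by (rule i)
  qed
qed

end

section \<open>Open sets, stalks and local derivations\<close>

lemma zariski_open_Diff: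
  fixes F :: "('v::finite, 'k::field) mpoly"
  assumes "zariski_open V" "homogeneous k F"
  shows "zariski_open {p \<in> V. F \<notin> p}"
proof -
  obtain I where I: "homogeneous_ideal I" "V = {p \<in> proj_points. \<not> I \<subseteq> p}"
    using assms(1) by (auto simp: zariski_open_def)
  \<comment> \<open>By primality the product of \<open>F\<close> and \<open>I\<close> cuts out the
    part of \<open>V\<close> where \<open>F\<close> does not vanish.\<close>
  define J where "J = (\<lambda>g. F * g) ` I"
  note ideal = homogeneous_idealD[OF I(1)]
  have J: "F * g \<in> J" if "g \<in> I" for g using that by (simp add: J_def)
  have "homogeneous_ideal J"
    unfolding homogeneous_ideal_def
  proof (intro conjI ballI allI)
    show "0 \<in> J" using J[OF ideal(1)] by simp
    show "f + g \<in> J" if "f \<in> J" "g \<in> J" for f g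
      using that ideal(2) unfolding J_def by (auto simp flip: distrib_left)
    show "h * f \<in> J" if "f \<in> J" for f h
      using that J ideal(3) by (auto simp: J_def mult.left_commute)
    show "hom_component n f \<in> J" if "f \<in> J" for f n
      using that J ideal(5) \<open>0 \<in> J\<close> by (auto simp: J_def hom_component_mult[OF assms(2)])
  qed
  moreover have "{p \<in> V. F \<notin> p} = {p \<in> proj_points. \<not> J \<subseteq> p}"
  proof -
    have "\<not> J \<subseteq> p \<longleftrightarrow> \<not> I \<subseteq> p \<and> F \<notin> p" if p: "p \<in> proj_points" for p
    proof -
      have "J \<subseteq> p \<longleftrightarrow> (\<forall>g\<in>I. F * g \<in> p)" by (auto simp: J_def)
      also have "\<dots> \<longleftrightarrow> (\<forall>g\<in>I. F \<in> p \<or> g \<in> p)"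
        using proj_pointsD(3)[OF p, of F] homogeneous_idealD(3,4)[OF proj_pointsD(1)[OF p]] by blast
      finally show ?thesis by blast
    qed
    then show ?thesis unfolding I(2) by blast
  qed
  ultimately show ?thesis unfolding zariski_open_def by blast
qed

lemma zariski_open_var: "zariski_open {p \<in> proj_points. var i \<notin> p}"
proof -
  have "zariski_open (proj_points :: ('a, 'b) mpoly set set)"
  proof -
    have "homogeneous_ideal (UNIV :: ('a, 'b) mpoly set)" by (simp add: homogeneous_ideal_def)
    moreover have "proj_points = {p \<in> proj_points. \<not> (UNIV :: ('a, 'b) mpoly set) \<subseteq> p}"
      using proj_pointsD(2) by blast
    ultimately show ?thesis unfolding zariski_open_def by blast
  qed
  from zariski_open_Diff[OF this homogeneous_var] show ?thesis .
qed

lemma stalk_mono: "I \<subseteq> J \<Longrightarrow> stalk I p \<subseteq> stalk J p"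
  unfolding stalk_def by blast

lemma stalkI:
  assumes "homogeneous n f" "homogeneous n g" "f \<in> I" "g \<notin> p"
  shows "Fract f g \<in> stalk I p"
  using assms unfolding stalk_def by blast

lemma local_derivationD:
  assumes "local_derivation \<iota> U D" "zariski_open V" "V \<noteq> {}" "V \<subseteq> U"
  shows "\<phi> \<in> structure_sheaf V \<Longrightarrow> D V \<phi> \<in> structure_sheaf V"
    and "\<phi> \<in> structure_sheaf V \<Longrightarrow> \<psi> \<in> structure_sheaf V \<Longrightarrow>
      D V (\<phi> * \<psi>) = \<phi> * D V \<psi> + \<psi> * D V \<phi>"
    and "zariski_open W \<Longrightarrow> base_change \<iota> ` V \<subseteq> W \<Longrightarrow> \<phi> \<in> pullback_sections \<iota> W \<Longrightarrow> D V \<phi> = 0"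
    and "zariski_open V' \<Longrightarrow> V' \<noteq> {} \<Longrightarrow> V' \<subseteq> V \<Longrightarrow> \<phi> \<in> structure_sheaf V \<Longrightarrow> D V' \<phi> = D V \<phi>"
proof -
  note * = mp[OF spec[OF assms(1)[unfolded local_derivation_def]], of V,
      OF conjI[OF assms(2) conjI[OF assms(3,4)]]]
  show "\<phi> \<in> structure_sheaf V \<Longrightarrow> D V \<phi> \<in> structure_sheaf V"
    by (rule bspec[OF conjunct1[OF *]])
  show "\<phi> \<in> structure_sheaf V \<Longrightarrow> \<psi> \<in> structure_sheaf V \<Longrightarrow>
      D V (\<phi> * \<psi>) = \<phi> * D V \<psi> + \<psi> * D V \<phi>"
    by (rule conjunct2[OF bspec[OF bspec[OF conjunct1[OF conjunct2[OF *]]]]])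
  show "zariski_open W \<Longrightarrow> base_change \<iota> ` V \<subseteq> W \<Longrightarrow> \<phi> \<in> pullback_sections \<iota> W \<Longrightarrow> D V \<phi> = 0"
    using conjunct1[OF conjunct2[OF conjunct2[OF *]]] by blast
  show "zariski_open V' \<Longrightarrow> V' \<noteq> {} \<Longrightarrow> V' \<subseteq> V \<Longrightarrow> \<phi> \<in> structure_sheaf V \<Longrightarrow> D V' \<phi> = D V \<phi>"
    using conjunct2[OF conjunct2[OF conjunct2[OF *]]] by blast
qed

text \<open>Near a point where the variable \<open>x\<close> does not vanish, a section of the ideal is
  a multiple of \<open>f / x ^ d\<close>, on which derivations vanish since it comes from \<open>K\<close>.\<close>

lemma X_invariant_principal:
  fixes \<iota> :: "'k::field \<Rightarrow> 'l::field" and f :: "('v::{finite,linorder}, 'k) mpoly"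
  assumes \<iota>: "field_embedding \<iota>" and f: "homogeneous d f"
    and mult: "\<And>h. Poly_Mapping.map \<iota> f * h \<in> q"
    and generated: "\<And>n g. g \<in> q \<Longrightarrow> homogeneous n g \<Longrightarrow>
      \<exists>h. g = Poly_Mapping.map \<iota> f * h \<and> homogeneous (n - d) h \<and> (h = 0 \<or> d \<le> n)"
  shows "X_invariant \<iota> q"
  unfolding X_invariant_def
proof (intro allI impI ballI, elim conjE)
  fix U D V \<phi>
  assume D: "local_derivation \<iota> U D" and V: "zariski_open V" "V \<noteq> {}" "V \<subseteq> U"
    and \<phi>: "\<phi> \<in> ideal_sheaf q V"
  define F where "F = Poly_Mapping.map \<iota> f"
  have F: "homogeneous d F" unfolding F_def by (rule homogeneous_map_embedding[OF \<iota> f])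
  show "D V \<phi> \<in> ideal_sheaf q V"
    unfolding ideal_sheaf_def mem_Collect_eq
  proof
    fix p assume p: "p \<in> V"
    have sub: "V \<subseteq> proj_points" using V(1) by (auto simp: zariski_open_def)
    with p have pp: "p \<in> proj_points" by blast
    obtain i where i: "var i \<notin> p" using proj_points_var[OF pp] .
    define x :: "('v, 'l) mpoly" where "x = var i"
    from \<phi> p have "\<phi> \<in> stalk q p" by (simp add: ideal_sheaf_def)
    then obtain g s n where g: "\<phi> = Fract g s" "homogeneous n g" "homogeneous n s" "g \<in> q" "s \<notin> p"
      unfolding stalk_def by blast
    obtain h where h: "g = F * h" "homogeneous (n - d) h" "h = 0 \<or> d \<le> n"
      using generated[OF g(4,2)] unfolding F_def by blast
    \<comment> \<open>On this smaller neighbourhood of \<open>p\<close> neither \<open>x\<close> nor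
      the denominator \<open>s\<close> vanishes, so both factors below are sections.\<close>
    define V' where "V' = {p \<in> {p \<in> V. x \<notin> p}. s \<notin> p}"
    have open': "zariski_open V'"
      unfolding V'_def x_def
      by (rule zariski_open_Diff[OF zariski_open_Diff[OF V(1) homogeneous_var] g(3)])
    have p': "p \<in> V'" using p i g(5) by (simp add: V'_def x_def)
    then have ne': "V' \<noteq> {}" by blast
    have V'V: "V' \<subseteq> V" by (auto simp: V'_def)
    with V(3) have V'U: "V' \<subseteq> U" by blast
    note D' = local_derivationD[OF D open' ne' V'U]
    have x: "homogeneous k (x ^ k)" for k unfolding x_def by (rule homogeneous_var_power)
    have xp: "x ^ k \<notin> p'" if "p' \<in> V'" for p' k
      using that sub proj_points_power[of p' x k] by (auto simp: V'_def)
    have nonzero: "r \<noteq> 0" if "r \<notin> p'" "p' \<in> proj_points" for r :: "('v, 'l) mpoly" and p'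
      using that homogeneous_idealD(1)[OF proj_pointsD(1)] by blast
    have s0: "s \<noteq> 0" and x0: "x ^ k \<noteq> 0" for k
      using nonzero[OF g(5) pp] nonzero[OF xp[OF p'] pp] by simp_all
    \<comment> \<open>The power \<open>x ^ d\<close> gives both factors degree zero; the first comes
      from \<open>K\<close>, the second collects what depends on \<open>L\<close>.\<close>
    define \<psi>1 where "\<psi>1 = Fract F (x ^ d)"
    define \<psi>2 where "\<psi>2 = Fract (h * x ^ d) s"
    have \<psi>1: "\<psi>1 \<in> structure_sheaf V'"
      unfolding ideal_sheaf_def \<psi>1_def using F x xp by (auto intro: stalkI)
    have hx: "homogeneous n (h * x ^ d)"
      using h(2,3) homogeneous_mult[OF h(2) x[of d]] by auto
    have \<psi>2: "\<psi>2 \<in> structure_sheaf V'"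
      unfolding ideal_sheaf_def \<psi>2_def using hx g(3) by (auto intro: stalkI simp: V'_def)
    have \<phi>_eq: "\<phi> = \<psi>1 * \<psi>2"
      unfolding \<psi>1_def \<psi>2_def using s0 x0 by (simp add: g(1) h(1) eq_fract mult_ac)
    have "D V' \<psi>1 = 0"
    proof (rule D'(3)[OF zariski_open_var[of i]])
      show "base_change \<iota> ` V' \<subseteq> {p \<in> proj_points. var i \<notin> p}"
      proof safe
        fix p' assume p': "p' \<in> V'"
        then show "base_change \<iota> p' \<in> proj_points"
          using V'V sub by (intro base_change_proj_points[OF \<iota>]) blast
        assume "var i \<in> base_change \<iota> p'"
        then have "x \<in> p'"
          unfolding base_change_def mem_Collect_eq map_embedding_var[OF \<iota>] x_def .
        then show False using p' by (simp add: V'_def)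
      qed
      have "Fract f (var i ^ d) \<in> structure_sheaf {p \<in> proj_points. var i \<notin> p}"
        unfolding ideal_sheaf_def
      proof (intro CollectI ballI)
        fix p' :: "('v, 'k) mpoly set" assume "p' \<in> {p \<in> proj_points. var i \<notin> p}"
        then have "var i ^ d \<notin> p'" using proj_points_power[of p' "var i" d] by blast
        then show "Fract f (var i ^ d) \<in> local_ring p'"
          by (rule stalkI[OF f homogeneous_var_power UNIV_I])
      qed
      moreover have "\<psi>1 = Fract (Poly_Mapping.map \<iota> f) (Poly_Mapping.map \<iota> (var i ^ d))"
        by (simp only: \<psi>1_def F_def x_def map_embedding_power[OF \<iota>] map_embedding_var[OF \<iota>])
      moreover have "(var i :: ('v, 'k) mpoly) ^ d \<noteq> 0"
        by (rule power_not_zero) (metis lookup_single_eq lookup_zero zero_neq_one)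
      ultimately show "\<psi>1 \<in> pullback_sections \<iota> {p \<in> proj_points. var i \<notin> p}"
        unfolding pullback_sections_def by blast
    qed
    \<comment> \<open>The Leibniz rule leaves only the term with the factor \<open>\<psi>1\<close>,
      so the numerator stays divisible by \<open>F\<close>. Compatibility with restriction carries
      this from \<open>V'\<close> back to \<open>V\<close>.\<close>
    then have "D V' \<phi> = \<psi>1 * D V' \<psi>2"
      unfolding \<phi>_eq using D'(2)[OF \<psi>1 \<psi>2] by simp
    moreover have "D V' \<phi> = D V \<phi>"
    proof -
      have "\<phi> \<in> structure_sheaf V"
        using \<phi> stalk_mono[of q UNIV] unfolding ideal_sheaf_def by blast
      then show ?thesis by (rule local_derivationD(4)[OF D V open' ne' V'V])
    qed
    moreover obtain a b k where ab: "D V' \<psi>2 = Fract a b" "homogeneous k a" "homogeneous k b" "b \<notin> p"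
    proof -
      have "D V' \<psi>2 \<in> local_ring p" using D'(1)[OF \<psi>2] p' by (simp add: ideal_sheaf_def)
      then show thesis using that unfolding stalk_def by blast
    qed
    ultimately have "D V \<phi> = Fract (F * a) (x ^ d * b)"
      by (simp add: \<psi>1_def)
    also have "\<dots> \<in> stalk q p"
    proof (rule stalkI)
      show "homogeneous (d + k) (F * a)" "homogeneous (d + k) (x ^ d * b)"
        using homogeneous_mult F x ab by blast+
      show "F * a \<in> q" unfolding F_def by (rule mult)
      show "x ^ d * b \<notin> p" using proj_pointsD(3)[OF pp] xp[OF p'] ab(4) by blast
    qed
    finally show "D V \<phi> \<in> stalk q p" .
  qed
qed

lemma (in parametrized_curve) Q_subset:
  assumes "homogeneous_ideal I" "F \<in> I" shows "Q \<subseteq> I"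
  using Q_generated homogeneous_idealD(4)[OF assms] by blast

lemma invariant_degree_parametrized_curve:
  fixes \<iota> :: "'k::field \<Rightarrow> 'l::field" and f :: "('v::{finite,linorder}, 'k) mpoly"
  assumes "field_embedding \<iota>" "homogeneous d f"
    and "parametrized_curve p (Poly_Mapping.map \<iota> f) v a b d"
    and "q \<in> proj_points" "Poly_Mapping.map \<iota> f \<in> q"
  shows "invariant_degree \<iota> 1 q d"
proof -
  interpret parametrized_curve p "Poly_Mapping.map \<iota> f" v a b d by fact
  have "Q \<subseteq> q" using Q_subset[OF proj_pointsD(1)[OF assms(4)] assms(5)] .
  then have "ideal_sheaf Q U \<subseteq> ideal_sheaf q U" for U
    using stalk_mono unfolding ideal_sheaf_def by blast
  moreover have "X_invariant \<iota> Q"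
    by (rule X_invariant_principal[OF assms(1,2) F_mult_in_Q]) (metis Q_generated_homogeneous)
  ultimately show ?thesis
    unfolding invariant_degree_def
    using Q_proj_points subvariety_dim_Q subvariety_degree_Q by blast
qed

subsection \<open>Lines and conics in the plane\<close>

context
  fixes a b j :: 3
  assumes distinct: "a \<noteq> b" "a \<noteq> j" "b \<noteq> j"
begin

lemma UNIV_3: "UNIV = {a, b, j}"
proof -
  have "card {a, b, j} = CARD(3)" using distinct by simp
  then show ?thesis by (metis card_subset_eq finite subset_UNIV)
qed

lemma exponent_eqI:
  "Poly_Mapping.lookup m a = Poly_Mapping.lookup n a \<Longrightarrow>
    Poly_Mapping.lookup m b = Poly_Mapping.lookup n b \<Longrightarrow>
    Poly_Mapping.lookup m j = Poly_Mapping.lookup n j \<Longrightarrow> m = n"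
proof (rule poly_mapping_eqI)
  fix i :: 3
  assume *: "Poly_Mapping.lookup m a = Poly_Mapping.lookup n a"
    "Poly_Mapping.lookup m b = Poly_Mapping.lookup n b"
    "Poly_Mapping.lookup m j = Poly_Mapping.lookup n j"
  have "i \<in> {a, b, j}" using UNIV_3 by blast
  with * show "Poly_Mapping.lookup m i = Poly_Mapping.lookup n i" by auto
qed

lemma total_degree_3: "total_degree m =
    Poly_Mapping.lookup m a + Poly_Mapping.lookup m b + Poly_Mapping.lookup m j"
  using distinct by (simp add: UNIV_3)

lemma monomial_value_3: "monomial_value p m =
    p a ^ Poly_Mapping.lookup m a * p b ^ Poly_Mapping.lookup m b * p j ^ Poly_Mapping.lookup m j"
  using distinct by (simp add: UNIV_3 mult.assoc)

definition line :: "'k::field \<Rightarrow> 'k \<Rightarrow> 'k \<Rightarrow> (3, 'k) mpoly" where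
  "line ca cb cj = scalar ca * var a + scalar cb * var b + scalar cj * var j"

text \<open>\<open>var j\<close> occurs only multiplied by \<open>var a\<close>, so for
  \<open>c3 \<noteq> 0\<close> the equation can be solved for it wherever \<open>var a\<close> is
  nonzero.\<close>

definition conic :: "'k::field \<Rightarrow> 'k \<Rightarrow> 'k \<Rightarrow> 'k \<Rightarrow> (3, 'k) mpoly" where
  "conic c0 c1 c2 c3 = scalar c0 * (var a * var a) + scalar c1 * (var a * var b) +
     scalar c2 * (var b * var b) + scalar c3 * (var a * var j)"

lemma homogeneous_line: "homogeneous 1 (line ca cb cj)"
  unfolding line_def
  by (intro homogeneous_add homogeneous_scalar_mult homogeneous_var)

lemma homogeneous_conic: "homogeneous 2 (conic c0 c1 c2 c3)"
proof -
  have "homogeneous 2 (var x * var y)" for x y :: 3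
    using homogeneous_mult[OF homogeneous_var homogeneous_var] by (simp only: one_add_one)
  then show ?thesis
    unfolding conic_def by (intro homogeneous_add homogeneous_scalar_mult)
qed

text \<open>The graph of \<open>r\<close> in the affine chart where the coordinate \<open>a\<close>
  equals 1.\<close>

definition graph_param :: "'l::field poly \<Rightarrow> 3 \<Rightarrow> 'l poly" where
  "graph_param r i = (if i = a then 1 else if i = b then [:0, 1:] else r)"

lemma graph_param_simps [simp]:
  "graph_param r a = 1" "graph_param r b = [:0, 1:]" "graph_param r j = r"
  using distinct by (auto simp: graph_param_def)

text \<open>The normal monomials are those in \<open>a\<close> and \<open>b\<close> alone, and the
  exponent of \<open>b\<close> is the degree of the image.\<close>

lemma parametrized_line:
  fixes ca cb cj :: "'l::field"
  assumes "cj \<noteq> 0"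
  shows "parametrized_curve (graph_param [:- ca / cj, - cb / cj:]) (line ca cb cj) j a b 1"
proof
  let ?p = "graph_param [:- ca / cj, - cb / cj:]"
  show "homogeneous 1 (line ca cb cj)" by (rule homogeneous_line)
  show "Poly_Mapping.lookup (line ca cb cj) (Poly_Mapping.single j 1) \<noteq> 0"
  proof -
    have "Poly_Mapping.single x (1::nat) \<noteq> Poly_Mapping.single j 1" if "x \<noteq> j" for x
      using that by (metis lookup_single_eq lookup_single_not_eq zero_neq_one)
    then show ?thesis
      using distinct assms
      by (simp add: line_def lookup_add scalar_def mult_single lookup_single del: One_nat_def)
  qed
  show "param ?p (line ca cb cj) = 0"
    unfolding line_def param_add param_mult param_var param_scalar
    using assms by (simp add: smult_monom add_monom)
  have val: "monomial_value ?p m = monom 1 (Poly_Mapping.lookup m b)"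
    if "Poly_Mapping.lookup m j < 1" for m
    using that by (simp add: monomial_value_3 monom_altdef)
  show "monomial_value ?p m \<noteq> 0" if "Poly_Mapping.lookup m j < 1" for m
    using val[OF that] by simp
  show "bij_betw (\<lambda>m. degree (monomial_value ?p m))
      {m. total_degree m = n \<and> Poly_Mapping.lookup m j < 1} {0..1 * n}" for n
  proof -
    let ?A = "{m. total_degree m = n \<and> Poly_Mapping.lookup m j < 1}"
    have "bij_betw (\<lambda>m. Poly_Mapping.lookup m b) ?A {0..1 * n}"
      by (rule bij_betw_byWitness[where f' = "\<lambda>k. Poly_Mapping.single a (n - k) + Poly_Mapping.single b k"])
        (use distinct in \<open>auto simp: total_degree_3 lookup_add lookup_single intro!: exponent_eqI\<close>)
    moreover have "degree (monomial_value ?p m) = Poly_Mapping.lookup m b" if "m \<in> ?A" for m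
    proof -
      have "Poly_Mapping.lookup m j < 1" using that by blast
      from val[OF this] show ?thesis by (simp only: degree_monom_eq[OF one_neq_zero])
    qed
    ultimately show ?thesis by (simp only: cong: bij_betw_cong)
  qed
qed (use distinct in auto)

text \<open>Here \<open>b\<close>, not \<open>j\<close>, is the distinguished variable, because
  \<open>c2 \<noteq> 0\<close> makes the form quadratic in it. A normal monomial has exponent 0 or 1
  in \<open>b\<close>; as \<open>?r\<close> has degree 2, its image has as degree that exponent plus
  twice the exponent of \<open>j\<close>.\<close>

lemma parametrized_conic:
  fixes c0 c1 c2 c3 :: "'l::field"
  assumes "c2 \<noteq> 0" "c3 \<noteq> 0"
  shows "parametrized_curve (graph_param [:- c0 / c3, - c1 / c3, - c2 / c3:])
    (conic c0 c1 c2 c3) b a b 2"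
proof
  let ?r = "[:- c0 / c3, - c1 / c3, - c2 / c3:]"
  let ?p = "graph_param ?r"
  show "homogeneous 2 (conic c0 c1 c2 c3)" by (rule homogeneous_conic)
  show "Poly_Mapping.lookup (conic c0 c1 c2 c3) (Poly_Mapping.single b 2) \<noteq> 0"
  proof -
    have 1: "Poly_Mapping.single a (1::nat) + Poly_Mapping.single x 1 \<noteq> Poly_Mapping.single b 2" for x
    proof
      assume "Poly_Mapping.single a (1::nat) + Poly_Mapping.single x 1 = Poly_Mapping.single b 2"
      then have "Poly_Mapping.lookup (Poly_Mapping.single a (1::nat) + Poly_Mapping.single x 1) a =
          Poly_Mapping.lookup (Poly_Mapping.single b 2) a" by (rule arg_cong)
      then show False using distinct by (simp add: lookup_add lookup_single)
    qed
    have 2: "Poly_Mapping.single b (1::nat) + Poly_Mapping.single b 1 = Poly_Mapping.single b 2"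
      by (simp add: numeral_2_eq_2 flip: single_add)
    show ?thesis
      using assms unfolding conic_def
      by (simp add: lookup_add scalar_def mult_single 2 del: One_nat_def)
        (simp add: lookup_single 1 del: One_nat_def)
  qed
  show "param ?p (conic c0 c1 c2 c3) = 0"
    unfolding conic_def param_add param_mult param_var param_scalar
    using assms by (simp add: smult_monom add_monom mult_monom)
  have val: "monomial_value ?p m = monom 1 (Poly_Mapping.lookup m b) * ?r ^ Poly_Mapping.lookup m j" for m
    by (simp add: monomial_value_3 monom_altdef)
  have r: "?r \<noteq> 0" "degree ?r = 2" using assms by auto
  show "monomial_value ?p m \<noteq> 0" for m
    unfolding val using r(1) by (simp only: mult_eq_0_iff power_eq_0_iff) simp
  have deg: "degree (monomial_value ?p m) = Poly_Mapping.lookup m b + 2 * Poly_Mapping.lookup m j" for m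
  proof -
    have "?r ^ k \<noteq> 0" for k using r(1) by (rule power_not_zero)
    then have "degree (monomial_value ?p m) =
        degree (monom (1::'l) (Poly_Mapping.lookup m b)) + degree (?r ^ Poly_Mapping.lookup m j)"
      unfolding val by (intro degree_mult_eq) simp_all
    then show ?thesis by (simp only: degree_power_eq[OF r(1)] r(2) degree_monom_eq[OF one_neq_zero] mult.commute)
  qed
  show "bij_betw (\<lambda>m. degree (monomial_value ?p m))
      {m. total_degree m = n \<and> Poly_Mapping.lookup m b < 2} {0..2 * n}" for n
    unfolding deg
  \<comment> \<open>The parity of \<open>k\<close> is the exponent of \<open>b\<close>, its half
    rounded down that of \<open>j\<close>, and \<open>a\<close> fills up the total degree. For
    \<open>k \<le> 2 * n\<close> the subtraction is not truncated.\<close>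
  proof (rule bij_betw_byWitness[where f' = "\<lambda>k. Poly_Mapping.single a (n - k mod 2 - k div 2) +
      Poly_Mapping.single b (k mod 2) + Poly_Mapping.single j (k div 2)"])
    have le: "k mod 2 + k div 2 \<le> n" if "k \<le> 2 * n" for k using that by presburger
    let ?g = "\<lambda>k. Poly_Mapping.single a (n - k mod 2 - k div 2) +
      Poly_Mapping.single b (k mod 2) + Poly_Mapping.single j (k div 2)"
    have g: "Poly_Mapping.lookup (?g k) a = n - k mod 2 - k div 2" "Poly_Mapping.lookup (?g k) b = k mod 2"
      "Poly_Mapping.lookup (?g k) j = k div 2" for k
      using distinct by (simp_all add: lookup_add lookup_single)
    show "\<forall>m\<in>{m. total_degree m = n \<and> Poly_Mapping.lookup m b < 2}.
        ?g (Poly_Mapping.lookup m b + 2 * Poly_Mapping.lookup m j) = m"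
    proof
      fix m assume "m \<in> {m. total_degree m = n \<and> Poly_Mapping.lookup m b < 2}"
      then show "?g (Poly_Mapping.lookup m b + 2 * Poly_Mapping.lookup m j) = m"
        by (intro exponent_eqI; simp only: g) (auto simp: total_degree_3)
    qed
    show "\<forall>k\<in>{0..2 * n}. Poly_Mapping.lookup (?g k) b + 2 * Poly_Mapping.lookup (?g k) j = k"
      by (simp only: g) simp
    show "(\<lambda>m. Poly_Mapping.lookup m b + 2 * Poly_Mapping.lookup m j) `
        {m. total_degree m = n \<and> Poly_Mapping.lookup m b < 2} \<subseteq> {0..2 * n}"
      by (auto simp: total_degree_3)
    show "?g ` {0..2 * n} \<subseteq> {m. total_degree m = n \<and> Poly_Mapping.lookup m b < 2}"
    proof safe
      fix k assume "k \<in> {0..2 * n}"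
      then show "total_degree (?g k) = n" "Poly_Mapping.lookup (?g k) b < 2"
        using le[of k] by (simp_all only: total_degree_3 g) auto
    qed
  qed
qed (use distinct in auto)

lemma map_line: "field_embedding \<iota> \<Longrightarrow>
    Poly_Mapping.map \<iota> (line ca cb cj) = line (\<iota> ca) (\<iota> cb) (\<iota> cj)"
  by (simp only: line_def map_embedding_add map_embedding_mult map_embedding_var map_embedding_scalar)

lemma map_conic: "field_embedding \<iota> \<Longrightarrow>
    Poly_Mapping.map \<iota> (conic c0 c1 c2 c3) = conic (\<iota> c0) (\<iota> c1) (\<iota> c2) (\<iota> c3)"
  by (simp only: conic_def map_embedding_add map_embedding_mult map_embedding_var map_embedding_scalar)

end

subsection \<open>Points of degree three\<close>

text \<open>Membership supplies some representative of the fraction with numerator in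
  \<open>p\<close>; cross multiplication and primality transfer this to the given one.\<close>

lemma Fract_in_max_ideal:
  assumes p: "p \<in> proj_points" and "Fract f s \<in> max_ideal p" "s \<notin> p"
  shows "f \<in> p"
proof -
  note I = proj_pointsD(1)[OF p]
  obtain g h where g: "Fract f s = Fract g h" "g \<in> p" "h \<notin> p"
    using assms(2) unfolding stalk_def by blast
  have "s \<noteq> 0" "h \<noteq> 0" using homogeneous_idealD(1)[OF I] g(3) assms(3) by auto
  with g(1) have "f * h = g * s" by (simp add: eq_fract)
  with homogeneous_idealD(4)[OF I g(2), of s] have "f * h \<in> p" by simp
  with proj_pointsD(3)[OF p] g(3) show ?thesis by blast
qed

lemma subspace_max_ideal:
  assumes p: "p \<in> proj_points"
  shows "module.subspace (\<lambda>c \<phi>. Fract (scalar c :: ('v::{finite,linorder}, 'k::field) mpoly) 1 * \<phi>)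
    (max_ideal p)"
proof -
  interpret V: vector_space "\<lambda>c \<phi>. Fract (scalar c :: ('v, 'k) mpoly) 1 * \<phi>"
    by (rule vector_space_Fract_scalar_mult)
  note I = homogeneous_idealD[OF proj_pointsD(1)[OF p]]
  show ?thesis
    unfolding V.subspace_def
  proof (intro conjI ballI allI)
    have "Fract 0 1 \<in> max_ideal p"
      by (rule stalkI[of 0]) (use I(1) proj_pointsD(2)[OF p] in auto)
    then show "0 \<in> max_ideal p" by (simp add: Zero_fract_def)
  next
    fix \<phi> \<psi> assume "\<phi> \<in> max_ideal p" "\<psi> \<in> max_ideal p"
    then obtain f g n f' g' k where
      1: "\<phi> = Fract f g" "homogeneous n f" "homogeneous n g" "f \<in> p" "g \<notin> p" and
      2: "\<psi> = Fract f' g'" "homogeneous k f'" "homogeneous k g'" "f' \<in> p" "g' \<notin> p"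
      unfolding stalk_def by blast
    have "g \<noteq> 0" "g' \<noteq> 0" using 1 2 I(1) by auto
    then have "\<phi> + \<psi> = Fract (f * g' + f' * g) (g * g')" using 1 2 by simp
    also have "\<dots> \<in> max_ideal p"
    proof (rule stalkI)
      show "homogeneous (n + k) (f * g' + f' * g)"
        using homogeneous_mult[OF 1(2) 2(3)] homogeneous_mult[OF 2(2) 1(3)]
        by (simp add: homogeneous_add add.commute)
      show "homogeneous (n + k) (g * g')" using homogeneous_mult[OF 1(3) 2(3)] .
      show "f * g' + f' * g \<in> p" using 1 2 I by simp
      show "g * g' \<notin> p" using 1 2 proj_pointsD(3)[OF p] by blast
    qed
    finally show "\<phi> + \<psi> \<in> max_ideal p" .
  next
    fix c \<phi> assume "\<phi> \<in> max_ideal p"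
    then obtain f g n where
      1: "\<phi> = Fract f g" "homogeneous n f" "homogeneous n g" "f \<in> p" "g \<notin> p"
      unfolding stalk_def by blast
    have "Fract (scalar c * f) g \<in> max_ideal p"
      by (rule stalkI[OF homogeneous_scalar_mult[OF 1(2)] 1(3) I(3)[OF 1(4)] 1(5)])
    then show "Fract (scalar c) 1 * \<phi> \<in> max_ideal p" by (simp add: 1(1))
  qed
qed

text \<open>Division by \<open>s\<close> moves forms of degree \<open>n\<close> into the local ring,
  where the dimension is known; clearing \<open>s\<close> turns the relation modulo the maximal
  ideal into one modulo \<open>P\<close>.\<close>

lemma residue_degree_dependent:
  fixes P :: "('v::{finite,linorder}, 'k::field) mpoly set"
  assumes P: "P \<in> proj_points" and d: "residue_degree P d"
    and s: "homogeneous n s" "s \<notin> P"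
    and J: "finite J" "d < card J" "\<And>j. j \<in> J \<Longrightarrow> homogeneous n (g j)"
  shows "\<exists>c. (\<exists>j\<in>J. c j \<noteq> 0) \<and> (\<Sum>j\<in>J. scalar (c j) * g j) \<in> P"
proof -
  have "Fract (g j) s \<in> local_ring P" if "j \<in> J" for j
    using stalkI[OF J(3)[OF that] s(1) UNIV_I s(2)] .
  then have "\<exists>c. (\<exists>j\<in>J. c j \<noteq> 0) \<and>
      (\<Sum>j\<in>J. Fract (scalar (c j)) 1 * Fract (g j) s) \<in> max_ideal P"
    by (rule quotient_dim_dependent[OF vector_space_Fract_scalar_mult subspace_max_ideal[OF P]
        d[unfolded residue_degree_def] J(1,2)])
  then obtain c where c: "\<exists>j\<in>J. c j \<noteq> 0"
    "(\<Sum>j\<in>J. Fract (scalar (c j)) 1 * Fract (g j) s) \<in> max_ideal P" by (elim exE conjE)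
  have s0: "s \<noteq> 0" using s(2) homogeneous_idealD(1)[OF proj_pointsD(1)[OF P]] by blast
  have "(\<Sum>j\<in>J. Fract (scalar (c j)) 1 * Fract (g j) s) = Fract (\<Sum>j\<in>J. scalar (c j) * g j) s"
    using J(1)
  proof (induction J rule: finite_induct)
    case empty
    show ?case using s0 by (simp add: Zero_fract_def eq_fract)
  next
    case (insert j J)
    then show ?case using s0 by (simp add: eq_fract algebra_simps)
  qed
  with c(2) have "Fract (\<Sum>j\<in>J. scalar (c j) * g j) s \<in> max_ideal P" by simp
  with c(1) show ?thesis using Fract_in_max_ideal[OF P _ s(2)] by blast
qed

lemma residue_degree_3_dependent:
  fixes P :: "('v::{finite,linorder}, 'k::field) mpoly set"
  assumes "P \<in> proj_points" "residue_degree P 3" "homogeneous n s" "s \<notin> P"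
    and "homogeneous n g0" "homogeneous n g1" "homogeneous n g2" "homogeneous n g3"
  obtains c0 c1 c2 c3 where "\<not> (c0 = 0 \<and> c1 = 0 \<and> c2 = 0 \<and> c3 = 0)"
    "scalar c0 * g0 + scalar c1 * g1 + scalar c2 * g2 + scalar c3 * g3 \<in> P"
proof -
  let ?g = "\<lambda>j::nat. if j = 0 then g0 else if j = 1 then g1 else if j = 2 then g2 else g3"
  have "\<exists>c. (\<exists>j\<in>{0,1,2,3}. c j \<noteq> 0) \<and> (\<Sum>j\<in>{0,1,2,3}. scalar (c j) * ?g j) \<in> P"
    by (rule residue_degree_dependent[OF assms(1-4)]) (use assms(5-8) in auto)
  then obtain c where "\<exists>j\<in>{0,1,2,3::nat}. c j \<noteq> 0" "(\<Sum>j\<in>{0,1,2,3}. scalar (c j) * ?g j) \<in> P"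
    by (elim exE conjE)
  then show thesis using that[of "c 0" "c 1" "c 2" "c 3"] by (auto simp: add.assoc)
qed

text \<open>With no linear relation between the coordinates, a relation between \<open>X\<^sup>2\<close>, \<open>X * Y\<close>, \<open>Y\<^sup>2\<close>
  and \<open>X * Z\<close> is the equation of a conic unless \<open>Y / X\<close> is quadratic over the ground field. In that
  case a relation between \<open>X\<^sup>2\<close>, \<open>X * Y\<close>, \<open>X * Z\<close> and \<open>Y * Z\<close> shows that \<open>Z / X\<close> lies in the
  field generated by \<open>Y / X\<close>, which is again a linear relation.\<close>

lemma residue_degree_3_conic:
  fixes P :: "('v::{finite,linorder}, 'k::field) mpoly set"
  assumes P: "P \<in> proj_points" and d: "residue_degree P 3"
    and hom: "homogeneous 1 X" "homogeneous 1 Y" "homogeneous 1 Z" and X: "X \<notin> P"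
    and indep: "\<And>\<alpha> \<beta> \<gamma>. scalar \<alpha> * X + scalar \<beta> * Y + scalar \<gamma> * Z \<in> P \<Longrightarrow>
      \<alpha> = 0 \<and> \<beta> = 0 \<and> \<gamma> = 0"
  obtains c0 c1 c2 c3 where "c2 \<noteq> 0" "c3 \<noteq> 0"
    "scalar c0 * (X * X) + scalar c1 * (X * Y) + scalar c2 * (Y * Y) + scalar c3 * (X * Z) \<in> P"
proof -
  note I = homogeneous_idealD[OF proj_pointsD(1)[OF P]]
  have prime: "g \<in> P" if "f * g \<in> P" "f \<notin> P" for f g
    using proj_pointsD(3)[OF P that(1)] that(2) by blast
  have hom2: "homogeneous 2 (f * g)" if "homogeneous 1 f" "homogeneous 1 g" for f g :: "('v, 'k) mpoly"
    using homogeneous_mult[OF that] by (simp only: one_add_one)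
  have XX: "X * X \<notin> P" using prime X by blast
  note dep = residue_degree_3_dependent[OF P d hom2[OF hom(1,1)] XX]
  obtain c0 c1 c2 c3 where c: "\<not> (c0 = 0 \<and> c1 = 0 \<and> c2 = 0 \<and> c3 = 0)"
    "scalar c0 * (X * X) + scalar c1 * (X * Y) + scalar c2 * (Y * Y) + scalar c3 * (X * Z) \<in> P"
    using dep[OF hom2[OF hom(1,1)] hom2[OF hom(1,2)] hom2[OF hom(2,2)] hom2[OF hom(1,3)]] .
  have c2: "c2 \<noteq> 0"
  proof
    \<comment> \<open>Without the term in \<open>Y * Y\<close> a factor \<open>X\<close> splits off,
      which leaves a linear relation.\<close>
    assume c2: "c2 = 0"
    then have "X * (scalar c0 * X + scalar c1 * Y + scalar c3 * Z) \<in> P"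
      using c(2) by (simp add: scalar_simps algebra_simps)
    from indep[OF prime[OF this X]] c(1) c2 show False by simp
  qed
  have c3: "c3 \<noteq> 0"
  proof
    assume c3: "c3 = 0"
    define G where "G = scalar c0 * (X * X) + scalar c1 * (X * Y) + scalar c2 * (Y * Y)"
    have G: "G \<in> P" using c(2) by (simp add: c3 scalar_simps G_def)
    obtain e0 e1 e2 e3 where e: "\<not> (e0 = 0 \<and> e1 = 0 \<and> e2 = 0 \<and> e3 = 0)"
      "scalar e0 * (X * X) + scalar e1 * (X * Y) + scalar e2 * (X * Z) + scalar e3 * (Y * Z) \<in> P"
      using dep[OF hom2[OF hom(1,1)] hom2[OF hom(1,2)] hom2[OF hom(1,3)] hom2[OF hom(2,3)]] .
    define H where "H = scalar e0 * (X * X) + scalar e1 * (X * Y) + scalar e2 * (X * Z) + scalar e3 * (Y * Z)"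
    have H: "H \<in> P" using e(2) by (simp add: H_def)
    \<comment> \<open>If \<open>y\<close> is a root of \<open>c2 * y ^ 2 + c1 * y + c0\<close>, then
      \<open>r + s * y\<close> is \<open>- c2\<close> times the conjugate of
      \<open>e2 + e3 * y\<close>, and \<open>N\<close> is \<open>- c2\<close> times its norm.
      \<open>\<alpha>\<close> and \<open>\<beta>\<close> come from reducing
      \<open>(r + s * y) * (e0 + e1 * y)\<close> by the quadratic relation.\<close>
    define r where "r = e3 * c1 - e2 * c2"
    define s where "s = e3 * c2"
    define N where "N = e2 * r - e3 * e3 * c0"
    define \<alpha> where "\<alpha> = e0 * r - e1 * e3 * c0"
    define \<beta> where "\<beta> = e0 * s + e1 * r - e1 * e3 * c1"
    \<comment> \<open>multiplication of the second relation by the conjugate of its \<open>Z\<close>-coefficient, modulo \<open>G\<close>\<close>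
    have norm: "(scalar r * X + scalar s * Y) * (scalar e2 * X + scalar e3 * Y) =
        scalar (e3 * e3) * G + X * (X * scalar N)"
      unfolding G_def r_def s_def N_def scalar_simps by (simp add: algebra_simps)
    have eq: "(scalar r * X + scalar s * Y) * H =
        (scalar (e1 * e3) * X + scalar (e3 * e3) * Z) * G + X * X * (scalar \<alpha> * X + scalar \<beta> * Y + scalar N * Z)"
      unfolding G_def H_def r_def s_def N_def \<alpha>_def \<beta>_def scalar_simps by (simp add: algebra_simps)
    have "X * X * (scalar \<alpha> * X + scalar \<beta> * Y + scalar N * Z) \<in> P"
      using I(6)[OF I(3)[OF H, of "scalar r * X + scalar s * Y"]
          I(3)[OF G, of "scalar (e1 * e3) * X + scalar (e3 * e3) * Z"]]
      unfolding eq by simp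
    \<comment> \<open>\<open>N\<close> is the coefficient of \<open>Z\<close> in a linear relation,
      so it vanishes; the identity \<open>norm\<close> then puts a product of two linear forms into
      \<open>P\<close>.\<close>
    from indep[OF prime[OF this XX]] have "N = 0" by simp
    then have "(scalar r * X + scalar s * Y) * (scalar e2 * X + scalar e3 * Y) \<in> P"
      using I(3)[OF G] by (simp add: norm scalar_simps)
    then have "scalar r * X + scalar s * Y \<in> P \<or> scalar e2 * X + scalar e3 * Y \<in> P"
      using proj_pointsD(3)[OF P] by blast
    then have "(r = 0 \<and> s = 0) \<or> (e2 = 0 \<and> e3 = 0)"
      using indep[of r s 0] indep[of e2 e3 0] by (auto simp: scalar_simps)
    then have e23: "e2 = 0" "e3 = 0" using c2 by (auto simp: r_def s_def)
    then have "X * (scalar e0 * X + scalar e1 * Y + scalar 0 * Z) \<in> P"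
      using e(2) by (simp add: scalar_simps algebra_simps)
    from indep[OF prime[OF this X]] e23 e(1) show False by simp
  qed
  from c2 c3 c(2) show thesis by (rule that)
qed

lemma line_or_conic_through_point:
  fixes P :: "(3, 'k::field) mpoly set"
  assumes P: "P \<in> proj_points" and d: "residue_degree P 3"
  obtains (line) a b j :: 3 and ca cb cj where "a \<noteq> b" "a \<noteq> j" "b \<noteq> j" "cj \<noteq> 0" "line a b j ca cb cj \<in> P"
  | (conic) a b j :: 3 and c0 c1 c2 c3 where "a \<noteq> b" "a \<noteq> j" "b \<noteq> j" "c2 \<noteq> 0" "c3 \<noteq> 0"
      "conic a b j c0 c1 c2 c3 \<in> P"
proof -
  obtain a :: 3 where a: "var a \<notin> P" using proj_points_var[OF P] .
  have "card (UNIV - {a}) = 2" by simp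
  then obtain b j where bj: "UNIV - {a} = {b, j}" "b \<noteq> j" by (meson card_2_iff)
  then have ab: "a \<noteq> b" "a \<noteq> j" "b \<noteq> a" "j \<noteq> a" by auto
  show thesis
  proof (cases "\<exists>\<alpha> \<beta> \<gamma>. \<not> (\<alpha> = 0 \<and> \<beta> = 0 \<and> \<gamma> = 0) \<and>
      scalar \<alpha> * var a + scalar \<beta> * var b + scalar \<gamma> * var j \<in> P")
    case True
    then obtain \<alpha> \<beta> \<gamma> where nz: "\<not> (\<alpha> = 0 \<and> \<beta> = 0 \<and> \<gamma> = 0)"
      and l: "scalar \<alpha> * var a + scalar \<beta> * var b + scalar \<gamma> * var j \<in> P" by blast
    \<comment> \<open>Some coefficient is nonzero; one of the three orderings of the coordinates
      puts it last, where \<open>parametrized_line\<close> needs it.\<close>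
    have "line a b j \<alpha> \<beta> \<gamma> \<in> P" "line a j b \<alpha> \<gamma> \<beta> \<in> P" "line b j a \<beta> \<gamma> \<alpha> \<in> P"
      using l ab bj(2) by (simp_all add: line_def add_ac del: One_nat_def)
    with nz ab bj(2) line show thesis by metis
  next
    case False
    have "\<alpha> = 0 \<and> \<beta> = 0 \<and> \<gamma> = 0"
      if "scalar \<alpha> * var a + scalar \<beta> * var b + scalar \<gamma> * var j \<in> P" for \<alpha> \<beta> \<gamma>
      using False that by blast
    from residue_degree_3_conic[OF P d homogeneous_var homogeneous_var homogeneous_var a this]
    obtain c0 c1 c2 c3 where c: "c2 \<noteq> 0" "c3 \<noteq> 0"
      "scalar c0 * (var a * var a) + scalar c1 * (var a * var b) + scalar c2 * (var b * var b) +
        scalar c3 * (var a * var j) \<in> P" .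
    with conic[OF ab(1,2) bj(2) c(1,2)] show thesis by (simp only: conic_def[OF ab(1,2) bj(2)])
  qed
qed

theorem proposition5p4:
  fixes \<iota> :: "'k::field \<Rightarrow> 'l::field"
    and P :: "(3, 'k) mpoly set"
    and P1 :: "(3, 'l) mpoly set"
  assumes "CHAR('k) = 3"
    and "separably_closed TYPE('k)"
    and "frobenius_root_field \<iota>"
    and "P \<in> proj_points"
    and "residue_degree P 3"
    and "P1 \<in> proj_points"
    and "base_change \<iota> P1 = P"
  shows "of_type \<iota> 1 P1 1 \<or> of_type \<iota> 1 P1 2"
proof -
  have \<iota>: "field_embedding \<iota>" using assms(3) by (simp add: frobenius_root_field_def)
  note nonzero = embedding_eq_0_iff[OF \<iota>]
  have mem: "Poly_Mapping.map \<iota> f \<in> P1" if "f \<in> P" for f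
    using that assms(7) by (auto simp: base_change_def)
  have "invariant_degree \<iota> 1 P1 1 \<or> invariant_degree \<iota> 1 P1 2"
    using assms(4,5)
  proof (cases rule: line_or_conic_through_point)
    case (line a b j ca cb cj)
    note dist = line(1-3)
    have "parametrized_curve (graph_param a b [:- \<iota> ca / \<iota> cj, - \<iota> cb / \<iota> cj:])
        (Poly_Mapping.map \<iota> (line a b j ca cb cj)) j a b 1"
      unfolding map_line[OF dist \<iota>] using line(4) by (intro parametrized_line[OF dist]) (simp add: nonzero)
    from invariant_degree_parametrized_curve[OF \<iota> homogeneous_line[OF dist] this assms(6) mem[OF line(5)]]
    show ?thesis ..
  next
    case (conic a b j c0 c1 c2 c3)
    note dist = conic(1-3)
    have "parametrized_curve (graph_param a b [:- \<iota> c0 / \<iota> c3, - \<iota> c1 / \<iota> c3, - \<iota> c2 / \<iota> c3:])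
        (Poly_Mapping.map \<iota> (conic a b j c0 c1 c2 c3)) b a b 2"
      unfolding map_conic[OF dist \<iota>] using conic(4,5) by (intro parametrized_conic[OF dist]) (simp_all add: nonzero)
    from invariant_degree_parametrized_curve[OF \<iota> homogeneous_conic[OF dist] this assms(6) mem[OF conic(6)]]
    show ?thesis ..
  qed
  \<comment> \<open>Degrees being positive, 1 is minimal if it occurs, and otherwise 2 is.\<close>
  moreover have "0 < d" if "invariant_degree \<iota> 1 P1 d" for d
    using that subvariety_degree_pos unfolding invariant_degree_def by blast
  ultimately show ?thesis
    unfolding of_type_def by (metis One_nat_def Suc_leI Suc_1 le_neq_implies_less)
qed

end
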